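(* Let $d\ge2$ and let $\mathcal{P}^d_{2s}$ be the class of all $d$-dimensional polytopes with at least two simplex facets. Then the set of $f$-vectors $\mathcal{F}(\mathcal{P}^d_{2s})\subset\mathbb{Z}^d$ with the operation $x\boxplus' y:=x+y-(f(\Delta_{d-1}),2)$ forms an affine semigroup, where the modified addition can be represented by glueing in simplex facets: the result $\pi(P)\cup Q$ of glueing any two polytopes $P,Q\in\mathcal{P}^d_{2s}$ in a simplex facet lies in $\mathcal{P}^d_{2s}$ and satisfies $f(\pi(P)\cup Q)=f(P)\boxplus' f(Q)$.
   Context: For a $d$-polytope $P$, $f(P)=(f_0(P),\dots,f_{d-1}(P))$, where $f_i(P)$ is the number of $i$-dimensional faces. $(f(\Delta_{d-1}),2)\in\mathbb{Z}^d$ is the vector $\big(\binom{d}{1},\binom{d}{2},\dots,\binom{d}{d-1},2\big)$, obtained by appending $2$ to the $f$-vector of the $(d-1)$-simplex. A simplex facet is a facet that is a $(d-1)$-simplex. An affine semigroup is a structure isomorphic to a subset of some $\mathbb{Z}^n$ closed under addition. Glueing in simplex facets: given $d$-polytopes $P,Q$ with simplex facets $F\subset P$ and $F'\subset Q$, choose a suitable projective transformation $\pi$ (not sending any point of $P$ to infinity) such that $\pi(P)\cap Q=\pi(F)=F'$, the union $R:=\pi(P)\cup Q$ is a convex polytope, and all proper faces of $\pi(F)=F'$ are also faces of $R$; such a $\pi$ exists, and $R$ is the result of the glueing. *)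

theory Defs
  imports "HOL-Analysis.Polytope" "Jordan_Normal_Form.Matrix"
begin

(* Z^n is "carrier_vec n" in the type of integer vectors of Jordan_Normal_Form.Matrix; the qualified
   names are needed because HOL-Analysis also has a type and a constant called "vec". *)

definition fvector :: "nat \<Rightarrow> 'a::euclidean_space set \<Rightarrow> int Matrix.vec" where
  "fvector d P = Matrix.vec d (\<lambda>i. int (card {F. F face_of P \<and> aff_dim F = int i}))"

definition simplex_facets :: "'a::euclidean_space set \<Rightarrow> 'a set set" where
  "simplex_facets P = {F. F facet_of P \<and> (aff_dim P - 1) simplex F}"

(* The ambient space may have dimension larger than d. The set of facets of a polytope is finite,
   so "card" is the true number of simplex facets. *)
definition polytopes_2s :: "nat \<Rightarrow> 'a::euclidean_space set set" where
  "polytopes_2s d = {P. polytope P \<and> aff_dim P = int d \<and> card (simplex_facets P) \<ge> 2}"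

(* The binomials are the face numbers of a (d-1)-simplex: position i counts faces of dimension i. *)
definition simplex_fvector_2 :: "nat \<Rightarrow> int Matrix.vec" where
  "simplex_fvector_2 d = Matrix.vec d (\<lambda>i. if i = d - 1 then 2 else int (d choose (i + 1)))"

definition boxplus :: "nat \<Rightarrow> int Matrix.vec \<Rightarrow> int Matrix.vec \<Rightarrow> int Matrix.vec" where
  "boxplus d x y = x + y - simplex_fvector_2 d"

definition affine_semigroup :: "'b set \<Rightarrow> ('b \<Rightarrow> 'b \<Rightarrow> 'b) \<Rightarrow> bool" where
  "affine_semigroup S opn \<longleftrightarrow>
     (\<forall>x\<in>S. \<forall>y\<in>S. opn x y \<in> S) \<and>
     (\<exists>(n::nat) (T :: int Matrix.vec set) \<phi>.
        T \<subseteq> carrier_vec n \<and> (\<forall>u\<in>T. \<forall>v\<in>T. u + v \<in> T) \<and>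
        bij_betw \<phi> S T \<and> (\<forall>x\<in>S. \<forall>y\<in>S. \<phi> (opn x y) = \<phi> x + \<phi> y))"

(* A projective transformation is an automorphism L of the space of homogeneous coordinates (x, t),
   in which the affine point x is (x, 1) and the points with t = 0 are at infinity. The map p is
   specified only on P, no point of which is sent to infinity. *)
definition projective_transformation_on ::
    "'a::euclidean_space set \<Rightarrow> ('a \<Rightarrow> 'a) \<Rightarrow> bool" where
  "projective_transformation_on P p \<longleftrightarrow>
     (\<exists>L :: 'a \<times> real \<Rightarrow> 'a \<times> real. linear L \<and> bij L \<and>
        (\<forall>x\<in>P. snd (L (x, 1)) \<noteq> 0 \<and> p x = fst (L (x, 1)) /\<^sub>R snd (L (x, 1))))"

(* p glues P to Q by identifying the facet F of P with the facet F' of Q; the result of the glueing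
   is p ` P \<union> Q. *)
definition glueing ::
    "('a::euclidean_space \<Rightarrow> 'a) \<Rightarrow> 'a set \<Rightarrow> 'a set \<Rightarrow> 'a set \<Rightarrow> 'a set \<Rightarrow> bool" where
  "glueing p P F Q F' \<longleftrightarrow>
     projective_transformation_on P p \<and>
     p ` P \<inter> Q = F' \<and> p ` F = F' \<and>
     polytope (p ` P \<union> Q) \<and>
     (\<forall>G. G face_of F' \<and> G \<noteq> F' \<longrightarrow> G face_of (p ` P \<union> Q))"

end

theory Submission imports Defs begin

text \<open>Suppose that P and Q meet in a common facet F, that their union is convex and that the proper
  faces of F are faces of the union. A segment from a point of P outside Q to a point of Q outside P
  crosses F, and this alone implies that the faces of the union of dimension less than d are exactly
  those of P and of Q other than F. The faces shared by P and Q are the proper faces of F, whose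
  numbers are binomial coefficients; this gives the modified addition.

  For the existence of a glueing, take homogeneous coordinates with respect to the vertices w of F'
  and one further point q0 of Q. A linear map sends P into the same coordinates, with F going
  to F'. Then the reflection z - c0(z) (2 q0 - M \<Sum>w) fixes F', moves P to the other side of F', and
  for large M makes it so flat that P lies beyond F' and beneath all other facets of Q.
  The isomorphism of the semigroup onto a subsemigroup of Z^d is the translation by the
  negative of (f(\<Delta>), 2).\<close>

section \<open>Projective transformations and faces\<close>

definition homog :: "'a \<Rightarrow> 'a \<times> real" where
  "homog x = (x, 1)"

lemma inj_homog: "inj homog"
  by (auto simp: inj_on_def homog_def)

lemma homog_convex_comb:
  "homog ((1 - u) *\<^sub>R x + u *\<^sub>R y) = (1 - u) *\<^sub>R homog x + u *\<^sub>R homog (y :: 'a::real_vector)"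
  by (simp add: homog_def)

text \<open>The differences \<open>x - a\<close> embed into the hyperplane with last coordinate 0,
  and \<open>homog a\<close> lies off it, so it contributes exactly one more dimension. For the
  empty set both sides are -1.\<close>

lemma aff_dim_homog:
  fixes S :: "'a::euclidean_space set"
  shows "aff_dim S = int (dim (homog ` S)) - 1"
proof (cases "S = {}")
  case True
  then show ?thesis by simp
next
  case False
  then obtain a where a: "a \<in> S" by blast
  let ?D = "(\<lambda>x. x - a) ` S" and ?e = "\<lambda>x::'a. (x, 0::real)"
  have lin: "linear ?e"
    by (auto intro: linearI)
  have 1: "aff_dim S = int (dim ?D)"
    using a by (intro aff_dim_eq_dim_subtract) (rule hull_inc)
  have 2: "dim (?e ` ?D) = dim ?D"
    by (rule dim_image_eq[OF lin]) (auto simp: inj_on_def)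
  have "span (?e ` ?D) \<subseteq> {z. snd z = 0}"
    by (rule span_minimal) (auto intro!: subspaceI)
  then have 3: "dim (insert (homog a) (?e ` ?D)) = dim ?D + 1"
    using 2 by (auto simp: dim_insert homog_def)
  have "span (homog ` S) = span (insert (homog a) (?e ` ?D))"
  proof (rule span_eq[THEN iffD2], intro conjI subsetI)
    fix z assume "z \<in> homog ` S"
    then obtain x where x: "x \<in> S" "z = homog x" by blast
    then have "z = homog a + ?e (x - a)"
      by (simp add: homog_def)
    moreover have "?e (x - a) \<in> insert (homog a) (?e ` ?D)"
      using x by blast
    ultimately show "z \<in> span (insert (homog a) (?e ` ?D))"
      by (metis insertI1 span_add span_base)
  next
    fix z assume z: "z \<in> insert (homog a) (?e ` ?D)"
    then consider "z = homog a" | x where "x \<in> S" "z = ?e (x - a)" by blast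
    then show "z \<in> span (homog ` S)"
    proof cases
      case 2
      then have "z = homog x - homog a" by (simp add: homog_def)
      then show ?thesis using a 2 by (metis imageI span_diff span_base)
    qed (use a in \<open>auto intro: span_base\<close>)
  qed
  then have "dim (homog ` S) = dim ?D + 1"
    using 3 by (metis dim_span)
  then show ?thesis using 1 by simp
qed

lemma homog_independent:
  fixes C :: "'a::euclidean_space set"
  assumes "\<not> affine_dependent C"
  shows "independent (homog ` C)"
proof -
  have fin: "finite C" and "aff_dim C = int (card C) - 1"
    using assms affine_independent_iff_card by auto
  then have "dim (homog ` C) = card (homog ` C)"
    using aff_dim_homog[of C] card_image[OF inj_on_subset[OF inj_homog subset_UNIV], of C] by simp
  then show ?thesis
    using fin by (intro card_le_dim_spanning[of _ "homog ` C"]) (auto simp: span_base)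
qed

text \<open>Only the image of a segment is prescribed, not its parametrization, because a projective
  map changes the ratios in which points divide a segment. Convex hulls and faces depend on segments
  alone.\<close>

definition preserves_segments_on :: "'a::euclidean_space set \<Rightarrow> ('a \<Rightarrow> 'b::euclidean_space) \<Rightarrow> bool" where
  "preserves_segments_on P p \<longleftrightarrow> inj_on p P \<and>
     (\<forall>x\<in>P. \<forall>y\<in>P. p ` closed_segment x y = closed_segment (p x) (p y))"

lemma image_open_segment:
  assumes "preserves_segments_on P p" "convex P" "x \<in> P" "y \<in> P"
  shows "p ` open_segment x y = open_segment (p x) (p y)"
proof -
  have "closed_segment x y \<subseteq> P"
    using assms by (simp add: closed_segment_subset)
  then have "inj_on p (closed_segment x y)"
    using assms(1) by (auto simp: preserves_segments_on_def intro: inj_on_subset)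
  then have "p ` (closed_segment x y - {x, y}) = p ` closed_segment x y - p ` {x, y}"
    by (rule inj_on_image_set_diff) auto
  then show ?thesis
    using assms by (simp add: open_segment_def preserves_segments_on_def)
qed

lemma convex_image_preserves_segments:
  assumes "preserves_segments_on P p" "G \<subseteq> P" "convex G"
  shows "convex (p ` G)"
  unfolding convex_contains_segment
proof (intro ballI)
  fix a b assume "a \<in> p ` G" "b \<in> p ` G"
  then obtain x y where xy: "x \<in> G" "y \<in> G" "a = p x" "b = p y" by blast
  then have "closed_segment a b = p ` closed_segment x y"
    using assms unfolding preserves_segments_on_def by (metis subsetD)
  also have "\<dots> \<subseteq> p ` G"
    using assms(3) xy by (intro image_mono closed_segment_subset)
  finally show "closed_segment a b \<subseteq> p ` G" .
qed

text \<open>The property passes to the inverse, so every transfer from \<open>P\<close> to its image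
  can also be run backwards.\<close>

lemma preserves_segments_inv:
  assumes "preserves_segments_on P p" "convex P"
  shows "preserves_segments_on (p ` P) (inv_into P p)"
proof -
  have inj: "inj_on p P" using assms by (simp add: preserves_segments_on_def)
  have "inv_into P p ` closed_segment (p x) (p y) = closed_segment x y" if "x \<in> P" "y \<in> P" for x y
  proof -
    have "closed_segment x y \<subseteq> P"
      using assms that by (simp add: closed_segment_subset)
    then have "inv_into P p ` (p ` closed_segment x y) = closed_segment x y"
      by (rule inv_into_image_cancel[OF inj])
    then show ?thesis
      using assms that by (simp add: preserves_segments_on_def)
  qed
  then show ?thesis
    using inj by (auto simp: preserves_segments_on_def inj_on_inv_into)
qed

text \<open>One inclusion holds because the image of the hull is convex; the other is the same
  argument for the inverse map, carried back by \<open>p\<close>.\<close>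

lemma image_convex_hull_preserves_segments:
  assumes p: "preserves_segments_on P p" and P: "convex P" and C: "C \<subseteq> P"
  shows "p ` (convex hull C) = convex hull (p ` C)"
proof
  have hP: "convex hull C \<subseteq> P"
    using P C by (rule hull_minimal[rotated])
  show "convex hull (p ` C) \<subseteq> p ` (convex hull C)"
    using convex_image_preserves_segments[OF p hP]
    by (intro hull_minimal) (auto intro: hull_inc)
  define q where "q = inv_into P p"
  have inj: "inj_on p P" using p by (simp add: preserves_segments_on_def)
  have hp: "convex hull (p ` C) \<subseteq> p ` P"
    using C convex_image_preserves_segments[OF p subset_refl P] by (intro hull_minimal) auto
  have "convex (q ` (convex hull (p ` C)))"
    using convex_image_preserves_segments[OF preserves_segments_inv[OF p P] hp] by (simp add: q_def)
  moreover have "C \<subseteq> q ` (convex hull (p ` C))"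
  proof
    fix x assume "x \<in> C"
    then have "q (p x) = x" "p x \<in> convex hull (p ` C)"
      using C inj by (auto simp: q_def hull_inc)
    then show "x \<in> q ` (convex hull (p ` C))" by force
  qed
  ultimately have "convex hull C \<subseteq> q ` (convex hull (p ` C))"
    by (intro hull_minimal)
  then have "p ` (convex hull C) \<subseteq> p ` (q ` (convex hull (p ` C)))"
    by blast
  also have "\<dots> = convex hull (p ` C)"
    using hp by (simp add: q_def image_inv_into_cancel)
  finally show "p ` (convex hull C) \<subseteq> convex hull (p ` C)" .
qed

lemma face_of_image_preserves_segments:
  assumes p: "preserves_segments_on P p" and P: "convex P" and G: "G face_of P"
  shows "p ` G face_of p ` P"
  unfolding face_of_def
proof (intro conjI ballI impI)
  have GP: "G \<subseteq> P" using G by (rule face_of_imp_subset)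
  have inj: "inj_on p P" using p by (simp add: preserves_segments_on_def)
  show "p ` G \<subseteq> p ` P" using GP by blast
  show "convex (p ` G)"
    using convex_image_preserves_segments[OF p GP face_of_imp_convex[OF G]] .
  fix a b z assume "a \<in> p ` P" "b \<in> p ` P" "z \<in> p ` G" and z: "z \<in> open_segment a b"
  then obtain x y w where w: "x \<in> P" "y \<in> P" "w \<in> G" "a = p x" "b = p y" "z = p w" by blast
  with z obtain w' where w': "w' \<in> open_segment x y" "p w' = p w"
    using image_open_segment[OF p P, of x y] by (metis imageE)
  have "w' \<in> P"
    using w' w P by (meson closed_segment_subset open_closed_segment subsetD)
  then have "w' = w" using inj w' w GP by (auto dest: inj_onD)
  then have "x \<in> G \<and> y \<in> G" using G w' w unfolding face_of_def by blast
  then show "a \<in> p ` G" "b \<in> p ` G" using w by auto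
qed

lemma face_of_image_iff:
  assumes p: "preserves_segments_on P p" and P: "convex P"
  shows "H face_of p ` P \<longleftrightarrow> (\<exists>G. G face_of P \<and> H = p ` G)"
proof
  assume H: "H face_of p ` P"
  have inj: "inj_on p P" using p by (simp add: preserves_segments_on_def)
  have "inv_into P p ` H face_of inv_into P p ` p ` P"
    using face_of_image_preserves_segments[OF preserves_segments_inv[OF p P]
        convex_image_preserves_segments[OF p subset_refl P] H] .
  also have "inv_into P p ` p ` P = P"
    by (rule inv_into_image_cancel[OF inj subset_refl])
  finally show "\<exists>G. G face_of P \<and> H = p ` G"
    using face_of_imp_subset[OF H] by (metis image_inv_into_cancel)
qed (use face_of_image_preserves_segments[OF p P] in blast)

text \<open>This makes \<open>L\<close> explicit and strengthens the nonzero last coordinate of a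
  projective transformation to a positive one. Positivity keeps the transformed segment parameters
  within [0, 1].\<close>

definition projective_map_on ::
    "'a::euclidean_space set \<Rightarrow> ('a \<times> real \<Rightarrow> 'a \<times> real) \<Rightarrow> ('a \<Rightarrow> 'a) \<Rightarrow> bool" where
  "projective_map_on P L p \<longleftrightarrow> linear L \<and> bij L \<and>
     (\<forall>x\<in>P. 0 < snd (L (homog x)) \<and> p x = fst (L (homog x)) /\<^sub>R snd (L (homog x)))"

lemma projective_map_onD:
  assumes "projective_map_on P L p" "x \<in> P"
  shows "L (homog x) = snd (L (homog x)) *\<^sub>R homog (p x)"
  using assms by (auto simp: projective_map_on_def homog_def prod_eq_iff)

text \<open>An affine function without zeros on a convex set has constant sign. If the last
  coordinate is negative on \<open>P\<close>, negating \<open>L\<close> changes the sign of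
  numerator and denominator alike and leaves \<open>p\<close> as it was.\<close>

lemma projective_transformation_on_imp_map:
  assumes "projective_transformation_on P p" "convex P"
  obtains L where "projective_map_on P L p"
proof -
  obtain L :: "'a \<times> real \<Rightarrow> 'a \<times> real" where L: "linear L" "bij L"
    and nz: "\<And>x. x \<in> P \<Longrightarrow> snd (L (homog x)) \<noteq> 0"
    and px: "\<And>x. x \<in> P \<Longrightarrow> p x = fst (L (homog x)) /\<^sub>R snd (L (homog x))"
    using assms(1) by (auto simp: projective_transformation_on_def homog_def)
  show ?thesis
  proof (cases "\<forall>x\<in>P. 0 < snd (L (homog x))")
    case True
    then show ?thesis using L px that by (auto simp: projective_map_on_def)
  next
    case False
    then obtain x where x: "x \<in> P" "snd (L (homog x)) < 0"
      using nz by (metis linorder_neqE_linordered_idom)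
    have neg: "snd (L (homog y)) < 0" if "y \<in> P" for y
    proof (rule ccontr)
      assume "\<not> snd (L (homog y)) < 0"
      then have y: "snd (L (homog y)) > 0" using nz[OF that] by simp
      \<comment> \<open>The parameter at which the last coordinate vanishes on the segment from
        \<open>x\<close> to \<open>y\<close>.\<close>
      define u where "u = - snd (L (homog x)) / (snd (L (homog y)) - snd (L (homog x)))"
      have u: "0 \<le> u" "u \<le> 1" using x y by (auto simp: u_def field_simps)
      have "snd (L (homog ((1 - u) *\<^sub>R x + u *\<^sub>R y)))
          = (1 - u) * snd (L (homog x)) + u * snd (L (homog y))"
        unfolding homog_convex_comb linear_add[OF L(1)] linear_cmul[OF L(1)] by simp
      also have "\<dots> = 0" using x y by (simp add: u_def field_simps)
      finally show False
        using nz assms(2) x(1) that u convexD_alt[of P x y u] by blast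
    qed
    have "linear (\<lambda>z. - L z)"
      using L(1) by (rule linear_compose_neg)
    moreover have "bij (\<lambda>z. - L z)"
      using bij_comp[OF L(2) bij_uminus] by (simp add: o_def)
    ultimately have "projective_map_on P (\<lambda>z. - L z) p"
      using neg px by (auto simp: projective_map_on_def)
    then show ?thesis by (rule that)
  qed
qed

lemma projective_map_on_preserves_segments:
  assumes p: "projective_map_on P L p" and P: "convex P"
  shows "preserves_segments_on P p"
  unfolding preserves_segments_on_def
proof (intro conjI ballI)
  note D = projective_map_onD[OF p]
  have lin: "linear L" and inj: "inj L" and pos: "\<And>x. x \<in> P \<Longrightarrow> 0 < snd (L (homog x))"
    and px: "\<And>x. x \<in> P \<Longrightarrow> p x = fst (L (homog x)) /\<^sub>R snd (L (homog x))"
    using p unfolding projective_map_on_def bij_def by blast+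
  show "inj_on p P"
  proof (rule inj_onI)
    fix x y assume xy: "x \<in> P" "y \<in> P" "p x = p y"
    let ?s = "snd (L (homog x))" and ?t = "snd (L (homog y))"
    have "L (homog x) = (?s / ?t) *\<^sub>R L (homog y)"
      using arg_cong[OF D[OF xy(2)], of "scaleR (?s / ?t)"] D[OF xy(1)] xy(3) pos[OF xy(2)]
      by simp
    \<comment> \<open>Equal images give proportional homogeneous vectors; their last coordinates are
      both 1, so the factor is 1.\<close>
    then have "L (homog x) = L ((?s / ?t) *\<^sub>R homog y)"
      by (simp add: linear_cmul[OF lin])
    then obtain c where "homog x = c *\<^sub>R homog y"
      using injD[OF inj] by blast
    then show "x = y" by (simp add: homog_def)
  qed
  fix x y assume xy: "x \<in> P" "y \<in> P"
  let ?s = "snd (L (homog x))" and ?t = "snd (L (homog y))"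
  have s: "?s > 0" and t: "?t > 0"
    using pos xy by blast+
  \<comment> \<open>\<open>p\<close> takes the parameter \<open>u\<close> to \<open>?v u\<close>:
    the weights \<open>1 - u\<close> and \<open>u\<close> are multiplied by the last coordinates
    \<open>?s\<close> and \<open>?t\<close> and rescaled to sum 1.\<close>
  let ?v = "\<lambda>u. u * ?t / ((1 - u) * ?s + u * ?t)"
  have den: "(1 - u) * ?s + u * ?t > 0" if "0 \<le> u" "u \<le> 1" for u
    using s t that by (cases "u = 0") (auto intro: add_nonneg_pos)
  have key: "p ((1 - u) *\<^sub>R x + u *\<^sub>R y) = (1 - ?v u) *\<^sub>R p x + ?v u *\<^sub>R p y"
    if u: "0 \<le> u" "u \<le> 1" for u
  proof -
    let ?d = "(1 - u) * ?s + u * ?t"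
    let ?z = "(1 - u) *\<^sub>R x + u *\<^sub>R y"
    have z: "?z \<in> P" using P xy u by (rule convexD_alt)
    have Lz: "L (homog ?z) = (1 - u) *\<^sub>R L (homog x) + u *\<^sub>R L (homog y)"
      unfolding homog_convex_comb linear_add[OF lin] linear_cmul[OF lin] ..
    then have sz: "snd (L (homog ?z)) = ?d" by simp
    have fx: "fst (L (homog x)) = ?s *\<^sub>R p x" and fy: "fst (L (homog y)) = ?t *\<^sub>R p y"
      using px[OF xy(1)] px[OF xy(2)] s t by simp_all
    have "fst (L (homog ?z)) = ((1 - u) * ?s) *\<^sub>R p x + (u * ?t) *\<^sub>R p y"
      unfolding Lz by (simp add: fx fy)
    then have "p ?z = (((1 - u) * ?s) *\<^sub>R p x + (u * ?t) *\<^sub>R p y) /\<^sub>R ?d"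
      using px[OF z] sz by simp
    also have "\<dots> = ((1 - u) * ?s / ?d) *\<^sub>R p x + (u * ?t / ?d) *\<^sub>R p y"
      by (simp add: scaleR_add_right divide_inverse_commute)
    also have "(1 - u) * ?s / ?d = 1 - ?v u"
      using den[OF u] by (simp add: field_simps)
    finally show ?thesis .
  qed
  show "p ` closed_segment x y = closed_segment (p x) (p y)"
  proof (intro equalityI subsetI)
    fix z assume "z \<in> p ` closed_segment x y"
    then obtain u where u: "0 \<le> u" "u \<le> 1" "z = p ((1 - u) *\<^sub>R x + u *\<^sub>R y)"
      by (auto simp: in_segment)
    have "0 \<le> ?v u" "?v u \<le> 1"
      using u s t den[of u] by (auto simp: field_simps)
    then show "z \<in> closed_segment (p x) (p y)"
      using key[OF u(1,2)] u(3) by (auto simp: in_segment)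
  next
    fix z assume "z \<in> closed_segment (p x) (p y)"
    then obtain v where v: "0 \<le> v" "v \<le> 1" "z = (1 - v) *\<^sub>R p x + v *\<^sub>R p y"
      by (auto simp: in_segment)
    \<comment> \<open>The inverse reparametrization, obtained from \<open>?v\<close> by exchanging
      \<open>?s\<close> and \<open>?t\<close>.\<close>
    define u where "u = v * ?s / ((1 - v) * ?t + v * ?s)"
    have d: "(1 - v) * ?t + v * ?s > 0"
      using s t v by (cases "v = 0") (auto intro: add_nonneg_pos)
    have u: "0 \<le> u" "u \<le> 1"
      using v s t d by (auto simp: u_def field_simps)
    have 1: "1 - u = (1 - v) * ?t / ((1 - v) * ?t + v * ?s)"
      using d by (simp add: u_def field_simps)
    have "(1 - u) * ?s + u * ?t = ?s * ?t / ((1 - v) * ?t + v * ?s)"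
    proof -
      have "(1 - v) * ?t / D * ?s + v * ?s / D * ?t = ?s * ?t / D" for D
        by (cases "D = 0") (simp_all add: field_simps)
      then show ?thesis using 1 by (metis u_def)
    qed
    then have "?v u = v"
      using s t d by (simp add: u_def)
    then show "z \<in> p ` closed_segment x y"
      using key[OF u] v(3) u by (auto simp: in_segment image_iff intro!: bexI[of _ "(1 - u) *\<^sub>R x + u *\<^sub>R y"])
  qed
qed

text \<open>On \<open>G\<close> the vectors \<open>homog (p x)\<close> and
  \<open>L (homog x)\<close> differ by positive factors, hence span the same space, and the
  injective \<open>L\<close> preserves dimension.\<close>

lemma projective_map_on_aff_dim:
  assumes p: "projective_map_on P L p" and G: "G \<subseteq> P"
  shows "aff_dim (p ` G) = aff_dim G"
proof -
  note D = projective_map_onD[OF p]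
  have lin: "linear L" and inj: "inj L" and pos: "\<And>x. x \<in> P \<Longrightarrow> 0 < snd (L (homog x))"
    using p by (auto simp: projective_map_on_def bij_def)
  have "span (homog ` p ` G) = span (L ` homog ` G)"
  proof (rule span_eq[THEN iffD2], intro conjI subsetI)
    fix z assume "z \<in> homog ` p ` G"
    then obtain x where x: "x \<in> G" "z = homog (p x)" by blast
    then have xP: "x \<in> P" using G by blast
    then have "z = inverse (snd (L (homog x))) *\<^sub>R L (homog x)"
      using D[OF xP] pos[OF xP] x(2)
      by (metis less_irrefl scaleR_scaleR left_inverse scaleR_one)
    then show "z \<in> span (L ` homog ` G)"
      using x by (metis imageI span_base span_scale)
  next
    fix z assume "z \<in> L ` homog ` G"
    then obtain x where x: "x \<in> G" "z = L (homog x)" by blast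
    then have "z = snd (L (homog x)) *\<^sub>R homog (p x)"
      using D G by blast
    then show "z \<in> span (homog ` p ` G)"
      using x by (metis imageI span_base span_scale)
  qed
  then have "dim (homog ` p ` G) = dim (L ` homog ` G)"
    by (metis dim_span)
  also have "\<dots> = dim (homog ` G)"
    by (rule dim_image_eq[OF lin]) (rule inj_on_subset[OF inj], simp)
  finally show ?thesis by (simp add: aff_dim_homog)
qed

text \<open>The image vertices are affinely independent by counting: their affine dimension is
  unchanged, and it is one less than their number.\<close>

lemma projective_map_on_simplex:
  assumes p: "projective_map_on P L p" and P: "convex P" and G: "G \<subseteq> P" and S: "n simplex G"
  shows "n simplex (p ` G)"
proof -
  obtain C where C: "finite C" "\<not> affine_dependent C" "int (card C) = n + 1" "G = convex hull C"
    using S by (auto simp: simplex)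
  have CP: "C \<subseteq> P" using C(4) G hull_subset[of C convex] by blast
  note seg = projective_map_on_preserves_segments[OF p P]
  have inj: "inj_on p C"
    using seg CP by (auto simp: preserves_segments_on_def intro: inj_on_subset)
  have "aff_dim (p ` C) = int (card (p ` C)) - 1"
    using projective_map_on_aff_dim[OF p CP] card_image[OF inj] C affine_independent_iff_card[of C]
    by simp
  then have "\<not> affine_dependent (p ` C)"
    using C by (simp add: affine_independent_iff_card)
  moreover have "p ` G = convex hull (p ` C)"
    using image_convex_hull_preserves_segments[OF seg P CP] C by simp
  ultimately show ?thesis
    using C card_image[OF inj] by (auto simp: simplex_def)
qed

lemma projective_map_on_polytope:
  assumes p: "projective_map_on P L p" and P: "polytope P"
  shows "polytope (p ` P)"
proof -
  obtain V where V: "finite V" "P = convex hull V"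
    using P by (auto simp: polytope_def)
  have "p ` P = convex hull (p ` V)"
    using image_convex_hull_preserves_segments[OF projective_map_on_preserves_segments[OF p], of V]
      V polytope_imp_convex[OF P] hull_subset[of V convex] by auto
  then show ?thesis using V by (simp add: polytope_convex_hull)
qed

section \<open>Faces of a union along a facet\<close>

text \<open>The segment is connected and covered by two closed sets that both meet it, so these meet
  each other on it.\<close>

lemma convex_Un_crossing:
  fixes S T :: "'a::euclidean_space set"
  assumes "closed S" "closed T" "convex (S \<union> T)" "x \<in> S" "y \<in> T"
  obtains z where "z \<in> S \<inter> T" "z \<in> closed_segment x y"
proof -
  have "closed_segment x y \<subseteq> S \<union> T"
    using assms by (intro closed_segment_subset) auto
  moreover have "closed (S \<inter> closed_segment x y)" "closed (T \<inter> closed_segment x y)"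
    using assms by auto
  ultimately have "S \<inter> T \<inter> closed_segment x y \<noteq> {}"
    using assms(4,5) connected_segment(1)[of x y] unfolding connected_closed by blast
  then show ?thesis using that by blast
qed

lemma open_segment_nested:
  fixes a b c z :: "'a::euclidean_space"
  assumes "c \<in> open_segment a b" "z \<in> open_segment c b"
  shows "c \<in> open_segment a z"
proof -
  obtain u where u: "0 < u" "u < 1" "c = (1 - u) *\<^sub>R a + u *\<^sub>R b" and ab: "a \<noteq> b"
    using assms(1) by (auto simp: in_segment)
  obtain v where v: "0 < v" "v < 1" "z = (1 - v) *\<^sub>R c + v *\<^sub>R b"
    using assms(2) by (auto simp: in_segment)
  \<comment> \<open>The parameter of \<open>z\<close> on the segment from \<open>a\<close> to
    \<open>b\<close>; hence \<open>c\<close> has parameter \<open>u / s\<close> on the segment from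
    \<open>a\<close> to \<open>z\<close>.\<close>
  define s where "s = u + v * (1 - u)"
  have s: "u < s" "s \<noteq> 0" using u v by (simp_all add: s_def add_pos_pos less_imp_neq[symmetric])
  have z: "z = a + s *\<^sub>R (b - a)"
    unfolding v(3) u(3) s_def by (simp add: algebra_simps)
  have "c = (1 - u / s) *\<^sub>R a + (u / s) *\<^sub>R z"
    unfolding z u(3) using s by (simp add: algebra_simps)
  moreover have "0 < u / s" "u / s < 1" using u s by auto
  moreover have "a \<noteq> z" using z ab s by simp
  ultimately show ?thesis unfolding in_segment by blast
qed

text \<open>The situation after \<open>P\<close> has been replaced by its projective image. The
  assumptions are symmetric in \<open>P\<close> and \<open>Q\<close> (see \<open>commute\<close>),
  so each result on faces of \<open>P\<close> serves for \<open>Q\<close> as well.\<close>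

locale facet_union =
  fixes P Q F :: "'a::euclidean_space set" and d :: nat
  assumes closed: "closed P" "closed Q"
    and convex: "convex P" "convex Q"
    and dim: "aff_dim P = int d" "aff_dim Q = int d"
    and facet: "F facet_of P" "F facet_of Q"
    and Int: "P \<inter> Q = F"
    and convex_Un: "convex (P \<union> Q)"
    and faces: "\<And>G. G face_of F \<Longrightarrow> G \<noteq> F \<Longrightarrow> G face_of (P \<union> Q)"
begin

lemma commute: "facet_union Q P F d"
proof
  show "Q \<inter> P = F" using Int by blast
  show "convex (Q \<union> P)" using convex_Un by (simp only: Un_commute)
  show "G face_of (Q \<union> P)" if "G face_of F" "G \<noteq> F" for G
    using faces[OF that] by (simp only: Un_commute)
qed (fact closed convex dim facet)+

lemma dim_F: "aff_dim F = int d - 1"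
  using facet dim by (simp add: facet_of_def)

lemma crossing:
  assumes "x \<in> P - Q" "y \<in> Q - P"
  obtains z where "z \<in> F" "z \<in> open_segment x y"
proof -
  obtain z where z: "z \<in> P \<inter> Q" "z \<in> closed_segment x y"
    using convex_Un_crossing[OF closed convex_Un] assms by blast
  then have "z \<in> open_segment x y"
    using assms by (auto simp: open_segment_def)
  then show ?thesis using z Int that by blast
qed

lemma not_subset: "\<not> P \<subseteq> Q"
  using Int dim dim_F by (auto simp: Int_absorb2)

text \<open>If \<open>G\<close> contained \<open>F\<close>, then \<open>F\<close> would be a proper
  face of \<open>G\<close>, forcing dimension \<open>d\<close> on \<open>G\<close>. So the
  intersection is a proper face of \<open>F\<close> and the assumption \<open>faces\<close> applies.
  This is how knowledge about \<open>F\<close> reaches the other faces of \<open>P\<close>.\<close>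

lemma face_Int_F:
  assumes G: "G face_of P" "aff_dim G < int d" "G \<noteq> F"
  shows "G \<inter> F face_of (P \<union> Q)"
proof (rule faces)
  have "F \<subseteq> P" using Int by blast
  moreover have "convex F"
    using facet(1) face_of_imp_convex unfolding facet_of_def by blast
  ultimately show "G \<inter> F face_of F"
    using face_of_slice[OF G(1), of F] by (simp add: Int_absorb1)
  show "G \<inter> F \<noteq> F"
  proof
    assume "G \<inter> F = F"
    then have "F face_of G"
      using facet(1) face_of_imp_subset[OF G(1)] unfolding facet_of_def
      by (metis face_of_subset inf_le1)
    then have "aff_dim F < aff_dim G"
      using G face_of_aff_dim_lt face_of_imp_convex by metis
    then show False using G dim_F by simp
  qed
qed

lemma face_Un:
  assumes G: "G face_of P" "aff_dim G < int d" "G \<noteq> F"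
  shows "G face_of (P \<union> Q)"
  unfolding face_of_def
proof (intro conjI ballI impI)
  note GF = face_Int_F[OF G]
  have GFD: "a \<in> G \<inter> F \<and> b \<in> G \<inter> F"
    if "a \<in> P \<union> Q" "b \<in> P \<union> Q" "c \<in> G \<inter> F" "c \<in> open_segment a b" for a b c
    using GF that unfolding face_of_def by blast
  have GD: "a \<in> G \<and> b \<in> G" if "a \<in> P" "b \<in> P" "c \<in> G" "c \<in> open_segment a b" for a b c
    using G(1) that unfolding face_of_def by blast
  show "G \<subseteq> P \<union> Q" using face_of_imp_subset[OF G(1)] by blast
  show "convex G" using G(1) by (rule face_of_imp_convex)
  \<comment> \<open>If \<open>c\<close> is off \<open>F\<close>, the segment from \<open>c\<close>
    to \<open>b\<close> meets \<open>F\<close> in some \<open>z\<close>. Then \<open>c\<close> lies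
    between \<open>a\<close> and \<open>z\<close>, so \<open>z\<close> is in \<open>G\<close>. Since
    \<open>G \<inter> F\<close> is a face of the union containing \<open>z\<close>, the endpoint
    \<open>c\<close> lies in \<open>F\<close> after all.\<close>
  have mixed: False
    if ab: "a \<in> P - Q" "b \<in> Q - P" and c: "c \<in> G" "c \<in> open_segment a b" for a b c
  proof (cases "c \<in> F")
    case True
    then show False using GFD[of a b c] ab c Int by blast
  next
    case False
    have cP: "c \<in> P" using c face_of_imp_subset[OF G(1)] by blast
    then have "c \<in> P - Q" using False Int by blast
    then obtain z where z: "z \<in> F" "z \<in> open_segment c b"
      using crossing ab(2) by blast
    have "c \<in> open_segment a z"
      using c(2) z(2) ab by (auto intro: open_segment_nested)
    then have "z \<in> G" using GD[of a z c] ab c z Int by blast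
    then have "c \<in> F" using GFD[of c b z] z ab cP by blast
    then show False using False by simp
  qed
  fix a b c assume ab: "a \<in> P \<union> Q" "b \<in> P \<union> Q" and c: "c \<in> G" "c \<in> open_segment a b"
  consider "a \<in> P" "b \<in> P" | "a \<in> Q" "b \<in> Q" | "a \<in> P - Q" "b \<in> Q - P" | "b \<in> P - Q" "a \<in> Q - P"
    using ab by blast
  then have "a \<in> G \<and> b \<in> G"
  proof cases
    case 1
    then show ?thesis using GD c by blast
  next
    case 2
    then have "c \<in> Q" using c convex(2) by (meson closed_segment_subset open_closed_segment subsetD)
    then have "c \<in> G \<inter> F" using c face_of_imp_subset[OF G(1)] Int by blast
    then show ?thesis using GFD[OF ab _ c(2)] by blast
  next
    case 3
    then show ?thesis using mixed c by blast
  next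
    case 4
    then show ?thesis using mixed c by (metis open_segment_commute)
  qed
  then show "a \<in> G" "b \<in> G" by auto
qed

text \<open>A point \<open>y\<close> of \<open>Q\<close> off the affine hull of \<open>P\<close> is
  joined to a point \<open>x\<close> of \<open>P - Q\<close>. The segment crosses \<open>F\<close>
  in \<open>z\<close>, and \<open>y\<close> lies on the line through \<open>x\<close> and
  \<open>z\<close>, which stays in that hull.\<close>

lemma aff_dim_Un: "aff_dim (P \<union> Q) = int d"
proof -
  have "Q \<subseteq> affine hull P"
  proof (rule ccontr)
    assume "\<not> Q \<subseteq> affine hull P"
    then obtain y where y: "y \<in> Q" "y \<notin> affine hull P" by blast
    then have "y \<in> Q - P" using hull_inc by fastforce
    moreover obtain x where x: "x \<in> P - Q" using not_subset by blast
    ultimately obtain z where z: "z \<in> F" "z \<in> open_segment x y" using crossing by blast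
    then obtain u where u: "0 < u" "z = (1 - u) *\<^sub>R x + u *\<^sub>R y"
      by (auto simp: in_segment)
    have "y = (1 - 1 / u) *\<^sub>R x + (1 / u) *\<^sub>R z"
      unfolding u(2) using u(1) by (simp add: algebra_simps)
    moreover have "x \<in> affine hull P" "z \<in> affine hull P"
      using x z Int by (auto intro: hull_inc)
    ultimately have "y \<in> affine hull P"
      using mem_affine[OF affine_affine_hull, of x P z "1 - 1 / u" "1 / u"] by simp
    then show False using y by simp
  qed
  then have "P \<union> Q \<subseteq> affine hull P" by (simp add: hull_subset)
  then have "aff_dim (P \<union> Q) \<le> aff_dim P"
    by (metis aff_dim_affine_hull aff_dim_subset)
  then show ?thesis using aff_dim_subset[of P "P \<union> Q"] dim by simp
qed

text \<open>\<open>F\<close> becomes an inner wall: some segment of the union crosses it with both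
  endpoints outside.\<close>

lemma not_face_Un: "\<not> F face_of (P \<union> Q)"
proof
  assume F: "F face_of (P \<union> Q)"
  obtain x y where xy: "x \<in> P - Q" "y \<in> Q - P"
    using not_subset facet_union.not_subset[OF commute] by blast
  then obtain z where "z \<in> F" "z \<in> open_segment x y" using crossing by blast
  then have "x \<in> F" using F xy unfolding face_of_def by blast
  then show False using xy Int by blast
qed

text \<open>Otherwise \<open>E\<close> has points \<open>x\<close> of \<open>P - Q\<close> and
  \<open>y\<close> of \<open>Q - P\<close>, and by convexity a crossing point \<open>z\<close> in
  \<open>F\<close>. By \<open>face_Int_F\<close> for \<open>E \<inter> P\<close>, the set
  \<open>E \<inter> P \<inter> F\<close> is a face of the union; it contains \<open>z\<close>, so it
  contains \<open>x\<close>, which puts \<open>x\<close> in \<open>Q\<close>.\<close>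

lemma face_UnD:
  assumes E: "E face_of (P \<union> Q)" "aff_dim E < int d"
  shows "E face_of P \<or> E face_of Q"
proof (rule ccontr)
  assume neg: "\<not> (E face_of P \<or> E face_of Q)"
  have sub: "E \<subseteq> P \<union> Q" using face_of_imp_subset[OF E(1)] .
  have EP: "E \<inter> P face_of P" and EQ: "E \<inter> Q face_of Q"
    using face_of_slice[OF E(1)] convex by (metis Int_absorb1 Un_upper1, metis Int_absorb1 Un_upper2)
  have "\<not> E \<subseteq> P" "\<not> E \<subseteq> Q"
    using neg EP EQ by (auto simp: Int_absorb2)
  then obtain x y where xy: "x \<in> P - Q" "y \<in> Q - P" "x \<in> E" "y \<in> E"
    using sub by blast
  then obtain z where z: "z \<in> F" "z \<in> open_segment x y" using crossing by blast
  then have "z \<in> E"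
    using face_of_imp_convex[OF E(1)] xy by (meson closed_segment_subset open_closed_segment subsetD)
  have "aff_dim (E \<inter> P) < int d"
    using aff_dim_subset[of "E \<inter> P" E] E by simp
  moreover have "E \<inter> P \<noteq> F" using xy Int by blast
  ultimately have "E \<inter> P \<inter> F face_of (P \<union> Q)"
    using face_Int_F EP by blast
  moreover have "z \<in> E \<inter> P \<inter> F" using z \<open>z \<in> E\<close> Int by blast
  ultimately have "x \<in> F" using z xy unfolding face_of_def by blast
  then show False using xy Int by blast
qed

lemma faces_Un:
  assumes "i < d"
  shows "{G. G face_of (P \<union> Q) \<and> aff_dim G = int i} =
    ({G. G face_of P \<and> aff_dim G = int i} - {F}) \<union> ({G. G face_of Q \<and> aff_dim G = int i} - {F})"
proof -
  have "G face_of (P \<union> Q) \<longleftrightarrow> (G face_of P \<or> G face_of Q) \<and> G \<noteq> F" if "aff_dim G = int i" for G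
    using that assms face_Un[of G] facet_union.face_Un[OF commute, of G] face_UnD[of G] not_face_Un
    unfolding Un_commute[of Q P] by auto
  then show ?thesis by blast
qed

text \<open>The overlap term for inclusion-exclusion. A common face lies in
  \<open>P \<inter> Q = F\<close>, and every face of \<open>F\<close> is a face of both
  sides.\<close>

lemma faces_Int:
  "({G. G face_of P \<and> aff_dim G = int i} - {F}) \<inter> ({G. G face_of Q \<and> aff_dim G = int i} - {F})
    = {G. G face_of F \<and> aff_dim G = int i} - {F}"
proof -
  have "G face_of F" if "G face_of P" "G face_of Q" for G
    using that Int by (intro face_of_subset[OF that(1)]) (auto dest: face_of_imp_subset)
  moreover have "G face_of P" "G face_of Q" if "G face_of F" for G
    using that facet face_of_trans unfolding facet_of_def by blast+
  ultimately show ?thesis by blast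
qed

end

section \<open>Face numbers of a simplex\<close>

lemma card_faces_affine_independent:
  fixes C :: "'a::euclidean_space set"
  assumes C: "\<not> affine_dependent C"
  shows "card {G. G face_of (convex hull C) \<and> aff_dim G = int i} = card C choose (i + 1)"
proof -
  have fin: "finite C" using C aff_independent_finite by blast
  have ind: "\<not> affine_dependent c" if "c \<subseteq> C" for c
    using affine_independent_subset[OF C that] .
  then have ad: "aff_dim (convex hull c) = int (card c) - 1" if "c \<subseteq> C" for c
    using that by (simp add: aff_dim_convex_hull aff_dim_affine_independent)
  have "{G. G face_of (convex hull C) \<and> aff_dim G = int i} = (hull) convex ` {c. c \<subseteq> C \<and> card c = i + 1}"
    using ad by (auto simp: face_of_convex_hull_affine_independent[OF C])
  \<comment> \<open>Affinely independent points are the extreme points of their hull, so the hull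
    determines them.\<close>
  moreover have "inj_on ((hull) convex) {c. c \<subseteq> C \<and> card c = i + 1}"
  proof (rule inj_onI)
    fix a b assume "a \<in> {c. c \<subseteq> C \<and> card c = i + 1}" "b \<in> {c. c \<subseteq> C \<and> card c = i + 1}"
      and eq: "convex hull a = convex hull b"
    then have "\<not> affine_dependent a" "\<not> affine_dependent b"
      using ind by auto
    note ep = this[THEN extreme_point_of_convex_hull_affine_independent]
    have "x \<in> a \<longleftrightarrow> x \<in> b" for x
      by (metis ep eq)
    then show "a = b" by blast
  qed
  ultimately show ?thesis
    using n_subsets[OF fin] by (simp add: card_image)
qed

section \<open>Existence of glueings\<close>

lemma convex_homog_halfspace:
  assumes "linear f"
  shows "convex {x :: 'a::euclidean_space. 0 \<le> (f (homog x) :: real)}"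
  unfolding convex_alt
  by (auto simp: homog_convex_comb linear_add[OF assms] linear_cmul[OF assms])

lemma linear_scaleR_const:
  assumes "linear f"
  shows "linear (\<lambda>z. (f z :: real) *\<^sub>R b)"
  by (rule linearI) (simp_all add: linear_add[OF assms] linear_cmul[OF assms] scaleR_add_left)

text \<open>\<open>c0\<close> and \<open>c v\<close> are the coordinate functionals of the basis of homogeneous vectors formed by \<open>p0\<close>
  and the vertices \<open>v\<close> of \<open>F\<close>, extended arbitrarily to the ambient space.\<close>
locale facet_frame =
  fixes P F :: "'a::euclidean_space set" and V :: "'a set" and p0 :: 'a
    and c0 :: "'a \<times> real \<Rightarrow> real" and c :: "'a \<Rightarrow> 'a \<times> real \<Rightarrow> real"
  assumes polytope: "polytope P"
    and face: "F face_of P" and F: "F = convex hull V" and finite: "finite V"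
    and p0: "p0 \<in> P" "p0 \<notin> F"
    and span: "homog ` P \<subseteq> span (homog ` insert p0 V)"
    and linear_c0: "linear c0" and linear_c: "\<And>v. v \<in> V \<Longrightarrow> linear (c v)"
    and c0: "c0 (homog p0) = 1" "\<And>v. v \<in> V \<Longrightarrow> c0 (homog v) = 0"
    and c: "\<And>v. v \<in> V \<Longrightarrow> c v (homog p0) = 0"
      "\<And>v w. v \<in> V \<Longrightarrow> w \<in> V \<Longrightarrow> c v (homog w) = (if v = w then 1 else 0)"
begin

lemma convex: "convex P"
  using polytope by (rule polytope_imp_convex)

lemma coordinates:
  assumes "z \<in> span (homog ` insert p0 V)"
  shows "z = c0 z *\<^sub>R homog p0 + (\<Sum>v\<in>V. c v z *\<^sub>R homog v)"
proof -
  have lin: "linear (\<lambda>z. c0 z *\<^sub>R homog p0 + (\<Sum>v\<in>V. c v z *\<^sub>R homog v))"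
    using linear_c0 linear_c
    by (intro linear_compose_add linear_compose_sum ballI linear_scaleR_const) auto
  show ?thesis
  proof (rule linear_eq_on_span[OF linear_id[unfolded id_def] lin _ assms])
    fix b assume "b \<in> homog ` insert p0 V"
    then consider "b = homog p0" | v where "v \<in> V" "b = homog v" by blast
    then show "b = c0 b *\<^sub>R homog p0 + (\<Sum>v\<in>V. c v b *\<^sub>R homog v)"
    proof cases
      case 1
      then show ?thesis using c0 c by simp
    next
      case 2
      then have "(\<Sum>w\<in>V. c w b *\<^sub>R homog w) = (\<Sum>w\<in>V. if w = v then homog v else 0)"
        using c by (intro sum.cong) auto
      then show ?thesis using 2 c0 finite by simp
    qed
  qed
qed

text \<open>On the hyperplane \<open>c0 = 0\<close> the values \<open>c v\<close> are barycentric
  coordinates with respect to \<open>V\<close>; that they sum to 1 is the last coordinate of the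
  expansion.\<close>

lemma zero_in_affine_hull:
  assumes "homog x \<in> span (homog ` insert p0 V)" "c0 (homog x) = 0"
  shows "(\<Sum>v\<in>V. c v (homog x)) = 1" "x = (\<Sum>v\<in>V. c v (homog x) *\<^sub>R v)"
proof -
  have eq: "homog x = (\<Sum>v\<in>V. c v (homog x) *\<^sub>R homog v)"
    using coordinates[OF assms(1)] assms(2) by simp
  show "(\<Sum>v\<in>V. c v (homog x)) = 1" "x = (\<Sum>v\<in>V. c v (homog x) *\<^sub>R v)"
    using arg_cong[OF eq, of snd] arg_cong[OF eq, of fst]
    by (simp_all add: fst_sum snd_sum homog_def)
qed

lemma zero_nonneg_in_F:
  assumes "homog x \<in> span (homog ` insert p0 V)" "c0 (homog x) = 0"
    and "\<And>v. v \<in> V \<Longrightarrow> 0 \<le> c v (homog x)"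
  shows "x \<in> F"
proof -
  have "(\<Sum>v\<in>V. c v (homog x) *\<^sub>R v) \<in> convex hull V"
    using zero_in_affine_hull(1)[OF assms(1,2)] assms(3) finite
    by (intro convex_sum) (auto intro: hull_inc)
  then show ?thesis using zero_in_affine_hull(2)[OF assms(1,2)] F by simp
qed

text \<open>The expansion puts \<open>x\<close> in the affine hull of \<open>F\<close>, and a face
  of a convex set is its intersection with its own affine hull.\<close>

lemma zero_in_F:
  assumes "x \<in> P" "c0 (homog x) = 0"
  shows "x \<in> F"
proof -
  have x: "homog x \<in> span (homog ` insert p0 V)"
    using assms span by blast
  have "(\<Sum>v\<in>V. c v (homog x) *\<^sub>R v) \<in> affine hull V"
    using zero_in_affine_hull(1)[OF x assms(2)] unfolding affine_hull_finite[OF finite] by blast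
  then have "x \<in> affine hull F"
    using zero_in_affine_hull(2)[OF x assms(2)] F by (simp add: affine_hull_convex_hull)
  then show ?thesis
    using face_of_imp_eq_affine_Int[OF convex face] assms(1) by blast
qed

lemma F_zero:
  assumes "x \<in> F"
  shows "c0 (homog x) = 0"
proof -
  have "F \<subseteq> {x. 0 \<le> c0 (homog x)} \<inter> {x. 0 \<le> - c0 (homog x)}"
    unfolding F using convex_homog_halfspace[OF linear_c0]
      convex_homog_halfspace[OF linear_compose_neg[OF linear_c0]] c0
    by (intro hull_minimal convex_Int) auto
  then show ?thesis using assms by fastforce
qed

lemma F_nonneg:
  assumes "x \<in> F" "v \<in> V"
  shows "0 \<le> c v (homog x)"
proof -
  have "F \<subseteq> {x. 0 \<le> c v (homog x)}"
    unfolding F using convex_homog_halfspace[OF linear_c] c assms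
    by (intro hull_minimal) auto
  then show ?thesis using assms by blast
qed

lemma c0_convex_comb:
  "c0 (homog ((1 - u) *\<^sub>R x + u *\<^sub>R y)) = (1 - u) * c0 (homog x) + u * c0 (homog y)"
  unfolding homog_convex_comb linear_add[OF linear_c0] linear_cmul[OF linear_c0] by simp

lemma c_convex_comb:
  assumes "v \<in> V"
  shows "c v (homog ((1 - u) *\<^sub>R x + u *\<^sub>R y)) = (1 - u) * c v (homog x) + u * c v (homog y)"
  unfolding homog_convex_comb linear_add[OF linear_c[OF assms]] linear_cmul[OF linear_c[OF assms]]
  by simp

lemma c0_crossing:
  assumes "c0 (homog x) < 0" "0 < c0 (homog y)"
  obtains z where "z \<in> open_segment x y" "c0 (homog z) = 0"
proof -
  let ?a = "c0 (homog x)" and ?b = "c0 (homog y)"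
  define u where "u = - ?a / (?b - ?a)"
  have u: "0 < u" "u < 1" using assms by (auto simp: u_def field_simps)
  have "c0 (homog ((1 - u) *\<^sub>R x + u *\<^sub>R y)) = 0"
    using assms unfolding c0_convex_comb by (simp add: u_def field_simps)
  moreover have "x \<noteq> y" using assms by auto
  ultimately show ?thesis
    using that u unfolding in_segment by blast
qed

text \<open>From a point with negative \<open>c0\<close>, the segment to \<open>p0\<close> would
  cross \<open>c0 = 0\<close> in a point of \<open>P\<close>, hence of \<open>F\<close>, and the
  face property would put \<open>p0\<close> into \<open>F\<close>.\<close>

lemma c0_nonneg:
  assumes "x \<in> P"
  shows "0 \<le> c0 (homog x)"
proof (rule ccontr)
  assume "\<not> 0 \<le> c0 (homog x)"
  then obtain z where z: "z \<in> open_segment x p0" "c0 (homog z) = 0"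
    using c0_crossing[of x p0] c0 by auto
  then have "z \<in> P"
    using assms p0 convex by (meson closed_segment_subset open_closed_segment subsetD)
  then have "z \<in> F" using z zero_in_F by blast
  then show False
    using face z p0 assms unfolding face_of_def by blast
qed

text \<open>It suffices to check finitely many generators, since the inequality cuts out a convex
  set. A generator with \<open>c0 = 0\<close> lies in \<open>F\<close>, where \<open>c v\<close> is
  nonnegative; at the others the ratio of \<open>c v\<close> to \<open>c0\<close> is a finite
  number.\<close>

lemma slope_bound:
  obtains M where "0 \<le> M" "\<And>x v. x \<in> P \<Longrightarrow> v \<in> V \<Longrightarrow> - M * c0 (homog x) \<le> c v (homog x)"
proof -
  obtain X where X: "Finite_Set.finite X" "P = convex hull X"
    using polytope by (auto simp: polytope_def)
  let ?q = "\<lambda>x v. \<bar>c v (homog x)\<bar> / c0 (homog x)"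
  \<comment> \<open>A crude common bound: the sum of all ratios. Generators with
    \<open>c0 = 0\<close> contribute 0, as division by zero yields 0.\<close>
  define M where "M = (\<Sum>x\<in>X. \<Sum>v\<in>V. ?q x v)"
  have XP: "x \<in> P" if "x \<in> X" for x
    using that X by (simp add: hull_inc)
  have q: "0 \<le> ?q x v" if "x \<in> X" for x v
    using c0_nonneg[OF XP[OF that]] by simp
  have "X \<subseteq> {x. 0 \<le> c v (homog x) + M * c0 (homog x)}" if v: "v \<in> V" for v
  proof
    fix x assume x: "x \<in> X"
    show "x \<in> {x. 0 \<le> c v (homog x) + M * c0 (homog x)}"
    proof (cases "c0 (homog x) = 0")
      case True
      then show ?thesis using F_nonneg[OF zero_in_F[OF XP[OF x]] v] by simp
    next
      case False
      then have pos: "0 < c0 (homog x)" using c0_nonneg[OF XP[OF x]] by simp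
      have "?q x v \<le> (\<Sum>v\<in>V. ?q x v)"
        using finite v q[OF x] by (intro member_le_sum) auto
      also have "\<dots> \<le> M"
        unfolding M_def using X(1) x q
        by (intro member_le_sum[of x X "\<lambda>x. \<Sum>v\<in>V. ?q x v"] sum_nonneg) auto
      finally have "\<bar>c v (homog x)\<bar> \<le> M * c0 (homog x)"
        using pos by (simp add: field_simps)
      then show ?thesis by simp
    qed
  qed
  moreover have "convex {x. 0 \<le> c v (homog x) + M * c0 (homog x)}" if v: "v \<in> V" for v
    using convex_homog_halfspace[OF linear_compose_add[OF linear_c[OF v] linear_scaleR_const[OF linear_c0, of M]]]
    by (simp add: mult.commute)
  ultimately have "P \<subseteq> {x. 0 \<le> c v (homog x) + M * c0 (homog x)}" if v: "v \<in> V" for v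
    unfolding X(2) using v by (intro hull_minimal) auto
  then have "- M * c0 (homog x) \<le> c v (homog x)" if "x \<in> P" "v \<in> V" for x v
    using that by fastforce
  moreover have "0 \<le> M" unfolding M_def using q by (intro sum_nonneg) auto
  ultimately show ?thesis using that by blast
qed

end

text \<open>With \<open>M < K\<close> the two slope bounds add up to strict positivity of all \<open>c v\<close> at the point where a
  segment from \<open>P\<close> to \<open>Q\<close> crosses the hyperplane \<open>c0 = 0\<close>. Hence it crosses in \<open>F\<close>, away from the
  proper faces of \<open>F\<close>.\<close>
locale opposite_polytope = facet_frame Q F V p0 c0 c
  for Q F :: "'a::euclidean_space set" and V p0 c0 c +
  fixes P :: "'a set" and K M :: real
  assumes opp_polytope: "polytope P"
    and opp_face: "F face_of P"
    and opp_span: "homog ` P \<subseteq> span (homog ` insert p0 V)"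
    and opp_c0: "\<And>x. x \<in> P \<Longrightarrow> c0 (homog x) \<le> 0"
    and opp_zero: "\<And>x. x \<in> P \<Longrightarrow> c0 (homog x) = 0 \<Longrightarrow> x \<in> F"
    and opp_slope: "\<And>x v. x \<in> P \<Longrightarrow> v \<in> V \<Longrightarrow> - K * c0 (homog x) \<le> c v (homog x)"
    and slope: "\<And>x v. x \<in> Q \<Longrightarrow> v \<in> V \<Longrightarrow> - M * c0 (homog x) \<le> c v (homog x)"
    and slopes: "M < K"
begin

lemma Int_eq: "P \<inter> Q = F"
proof
  show "P \<inter> Q \<subseteq> F"
    using opp_c0 c0_nonneg opp_zero by (meson IntD1 IntD2 order_antisym subsetI)
  show "F \<subseteq> P \<inter> Q"
    using opp_face face by (simp add: face_of_imp_subset)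
qed

lemma crossing_pos:
  assumes x: "x \<in> P" "c0 (homog x) < 0" and y: "y \<in> Q"
    and z: "z \<in> open_segment x y" "c0 (homog z) = 0" and v: "v \<in> V"
  shows "0 < c v (homog z)"
proof -
  obtain u where u: "0 < u" "u < 1" "z = (1 - u) *\<^sub>R x + u *\<^sub>R y"
    using z by (auto simp: in_segment)
  let ?a = "c0 (homog x)" and ?b = "c0 (homog y)"
  have 0: "(1 - u) * ?a + u * ?b = 0"
    using z(2) unfolding u(3) c0_convex_comb .
  have "(1 - u) * (- K * ?a) + u * (- M * ?b) \<le> c v (homog z)"
    unfolding u(3) c_convex_comb[OF v] using opp_slope[OF x(1) v] slope[OF y v] u
    by (intro add_mono mult_left_mono) auto
  \<comment> \<open>As \<open>c0\<close> vanishes at \<open>z\<close>, the term with factor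
    \<open>K\<close> drops out; what remains is \<open>K - M\<close> times a positive
    number.\<close>
  also have "(1 - u) * (- K * ?a) + u * (- M * ?b)
      = - K * ((1 - u) * ?a + u * ?b) + (K - M) * (u * ?b)"
    by (simp add: algebra_simps)
  also have "\<dots> = (K - M) * ((1 - u) * - ?a)"
    using 0 by (metis add.left_neutral add_eq_0_iff mult_minus_right mult_zero_right)
  finally show ?thesis
    using u x(2) slopes by (smt (verit) mult_pos_pos)
qed

lemma crossing_in_F:
  assumes x: "x \<in> P" "c0 (homog x) < 0" and y: "y \<in> Q"
    and z: "z \<in> open_segment x y" "c0 (homog z) = 0"
  shows "z \<in> F"
proof (rule zero_nonneg_in_F)
  obtain u where u: "z = (1 - u) *\<^sub>R x + u *\<^sub>R y"
    using z by (auto simp: in_segment)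
  show "homog z \<in> span (homog ` insert p0 V)"
    unfolding u homog_convex_comb using x y opp_span span
    by (intro span_add span_scale) auto
  show "0 \<le> c v (homog z)" if "v \<in> V" for v
    using crossing_pos[OF assms that] by simp
qed (fact z)

lemma convex_union: "convex (P \<union> Q)"
proof -
  have mixed: "closed_segment x y \<subseteq> P \<union> Q" if xy: "x \<in> P" "y \<in> Q" for x y
  proof -
    have PQ: "closed_segment a b \<subseteq> P" if "a \<in> P" "b \<in> P" for a b
      using that polytope_imp_convex[OF opp_polytope] by (simp add: closed_segment_subset)
    have QQ: "closed_segment a b \<subseteq> Q" if "a \<in> Q" "b \<in> Q" for a b
      using that convex by (simp add: closed_segment_subset)
    \<comment> \<open>If either point lies on the hyperplane, it belongs to \<open>F\<close> and
      both points share a polytope; only strictly opposite sides require a crossing.\<close>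
    consider "c0 (homog x) = 0" | "c0 (homog y) = 0" | "c0 (homog x) < 0" "0 < c0 (homog y)"
      using opp_c0[OF xy(1)] c0_nonneg[OF xy(2)] by linarith
    then show ?thesis
    proof cases
      case 1
      then have "x \<in> Q" using opp_zero xy Int_eq by blast
      then show ?thesis using QQ xy by blast
    next
      case 2
      then have "y \<in> P" using zero_in_F xy Int_eq by blast
      then show ?thesis using PQ xy by blast
    next
      case 3
      then obtain z where z: "z \<in> open_segment x y" "c0 (homog z) = 0"
        by (rule c0_crossing)
      then have "z \<in> F" using crossing_in_F xy 3 by blast
      then have "z \<in> P" "z \<in> Q" using Int_eq by auto
      moreover have "closed_segment x y = closed_segment x z \<union> closed_segment z y"
        using z(1) by (intro Un_closed_segment[symmetric] open_closed_segment)
      ultimately show ?thesis using PQ[OF xy(1)] QQ[OF _ xy(2)] by blast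
    qed
  qed
  have "closed_segment x y \<subseteq> P \<union> Q" if xy: "x \<in> P \<union> Q" "y \<in> P \<union> Q" for x y
  proof -
    consider "x \<in> P" "y \<in> P" | "x \<in> Q" "y \<in> Q" | "x \<in> P" "y \<in> Q" | "y \<in> P" "x \<in> Q"
      using xy by blast
    then show ?thesis
    proof cases
      case 1
      then show ?thesis
        using closed_segment_subset[OF _ _ polytope_imp_convex[OF opp_polytope]] by blast
    next
      case 2
      then show ?thesis using closed_segment_subset[OF _ _ convex] by blast
    next
      case 3
      then show ?thesis by (rule mixed)
    next
      case 4
      then show ?thesis using mixed closed_segment_commute by metis
    qed
  qed
  then show ?thesis by (simp add: convex_contains_segment)
qed

lemma polytope_union: "polytope (P \<union> Q)"
proof -
  obtain X Y where XY: "Finite_Set.finite X" "P = convex hull X" "Finite_Set.finite Y" "Q = convex hull Y"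
    using opp_polytope polytope by (auto simp: polytope_def)
  have "convex hull (X \<union> Y) \<subseteq> P \<union> Q"
    using convex_union XY by (intro hull_minimal) (auto intro: hull_inc)
  moreover have "P \<union> Q \<subseteq> convex hull (X \<union> Y)"
    using XY by (simp add: hull_mono)
  ultimately have "P \<union> Q = convex hull (X \<union> Y)" by blast
  then show ?thesis using XY by (simp add: polytope_convex_hull)
qed

text \<open>A proper face \<open>G\<close> omits a vertex \<open>w\<close> of \<open>F\<close>, so
  \<open>c w\<close> is at most 0 on \<open>G\<close>. By \<open>crossing_pos\<close>, a segment
  from a point of \<open>P\<close> off \<open>F\<close> to a point of \<open>Q\<close> crosses the
  hyperplane where \<open>c w\<close> is positive and so avoids \<open>G\<close>.\<close>

lemma face_of_union:
  assumes G: "G face_of F" "G \<noteq> F"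
  shows "G face_of (P \<union> Q)"
proof -
  obtain W where W: "W \<subseteq> V" "G = convex hull W"
    using face_of_convex_hull_subset[of V G] G(1) F finite_imp_compact[OF finite] by blast
  then have "W \<noteq> V" using G(2) F by blast
  then obtain w where w: "w \<in> V" "w \<notin> W" using W(1) by blast
  have "G \<subseteq> {x. 0 \<le> - c w (homog x)}"
    unfolding W(2) using c w W(1) convex_homog_halfspace[OF linear_compose_neg[OF linear_c[OF w(1)]]]
    by (intro hull_minimal) auto
  then have cw: "c w (homog z) \<le> 0" if "z \<in> G" for z
    using that by auto
  have GP: "G face_of P" and GQ: "G face_of Q"
    using face_of_trans[OF G(1)] opp_face face by blast+
  have GF: "G \<subseteq> F" using G(1) by (rule face_of_imp_subset)
  have mixed: "x \<in> G \<and> y \<in> G"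
    if xy: "x \<in> P" "y \<in> Q" and z: "z \<in> G" "z \<in> open_segment x y" for x y z
  proof (cases "c0 (homog x) = 0")
    case True
    then have "x \<in> Q" using opp_zero xy Int_eq by blast
    then show ?thesis using GQ xy z unfolding face_of_def by blast
  next
    case False
    then have "c0 (homog x) < 0" using opp_c0 xy by fastforce
    moreover have "c0 (homog z) = 0" using F_zero z GF by blast
    ultimately have "0 < c w (homog z)" using crossing_pos xy z w by blast
    then show ?thesis using cw[OF z(1)] by simp
  qed
  show ?thesis
    unfolding face_of_def
  proof (intro conjI ballI impI)
    show "G \<subseteq> P \<union> Q" using face_of_imp_subset[OF GP] by blast
    show "convex G" using G(1) by (rule face_of_imp_convex)
    fix x y z assume xy: "x \<in> P \<union> Q" "y \<in> P \<union> Q" and z: "z \<in> G" "z \<in> open_segment x y"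
    consider "x \<in> P" "y \<in> P" | "x \<in> Q" "y \<in> Q" | "x \<in> P" "y \<in> Q" | "y \<in> P" "x \<in> Q"
      using xy by blast
    then have "x \<in> G \<and> y \<in> G"
    proof cases
      case 1
      then show ?thesis using GP z unfolding face_of_def by blast
    next
      case 2
      then show ?thesis using GQ z unfolding face_of_def by blast
    next
      case 3
      then show ?thesis using mixed z by blast
    next
      case 4
      then show ?thesis using mixed[OF 4 z(1)] z(2) open_segment_commute by blast
    qed
    then show "x \<in> G" "y \<in> G" by auto
  qed
qed

end

section \<open>Construction of the glueing map\<close>

lemma homog_dual_functional:
  fixes C :: "'a::euclidean_space set"
  assumes "\<not> affine_dependent C"
  obtains f :: "'a \<times> real \<Rightarrow> real" where "linear f" "\<And>x. x \<in> C \<Longrightarrow> f (homog x) = h x"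
proof -
  obtain f :: "'a \<times> real \<Rightarrow> real" where "linear f" "\<forall>z\<in>homog ` C. f z = h (fst z)"
    using linear_independent_extend[OF homog_independent[OF assms], of "\<lambda>z. h (fst z)"] by blast
  then show ?thesis using that by (auto simp: homog_def)
qed

text \<open>The \<open>d\<close> vertices of the facet and one point off it are affinely
  independent; their \<open>d + 1\<close> homogeneous vectors reach the dimension of the span of
  \<open>P\<close>.\<close>

lemma simplex_facet_frame:
  assumes P: "P \<in> polytopes_2s d" and F: "F \<in> simplex_facets P"
  obtains V p0 where "finite V" "card V = d" "F = convex hull V" "p0 \<in> P" "p0 \<notin> F"
    "\<not> affine_dependent (insert p0 V)" "homog ` P \<subseteq> span (homog ` insert p0 V)"
proof -
  have poly: "polytope P" and dim: "aff_dim P = int d"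
    using P by (auto simp: polytopes_2s_def)
  have facet: "F facet_of P" and "(int d - 1) simplex F"
    using F dim by (auto simp: simplex_facets_def)
  then obtain V where V: "finite V" "\<not> affine_dependent V" "card V = d" "F = convex hull V"
    by (auto simp: simplex)
  have face: "F face_of P" and dimF: "aff_dim F = int d - 1"
    using facet dim by (auto simp: facet_of_def)
  then have "F \<noteq> P" using dim by auto
  then obtain p0 where p0: "p0 \<in> P" "p0 \<notin> F"
    using face_of_imp_subset[OF face] by blast
  have "p0 \<notin> affine hull V"
    using face_of_imp_eq_affine_Int[OF polytope_imp_convex[OF poly] face] p0 V(4)
    by (auto simp: affine_hull_convex_hull)
  then have ind: "\<not> affine_dependent (insert p0 V)" and nin: "p0 \<notin> V"
    using affine_independent_insert V(2) hull_inc by (blast, metis hull_inc)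
  have sub: "insert p0 V \<subseteq> P"
    using p0 V(4) face_of_imp_subset[OF face] hull_subset[of V convex] by auto
  have "aff_dim (insert p0 V) = int d"
    using aff_dim_affine_independent[OF ind] V(1,3) nin by simp
  then have "dim (homog ` P) \<le> dim (homog ` insert p0 V)"
    using dim aff_dim_homog[of P] aff_dim_homog[of "insert p0 V"] by simp
  then have "span (homog ` insert p0 V) = span (homog ` P)"
    using sub by (intro dim_eq_span) auto
  then have "homog ` P \<subseteq> span (homog ` insert p0 V)"
    by (simp add: span_superset)
  then show ?thesis using that V p0 ind by blast
qed

lemma ex_glueing:
  fixes P Q :: "'a::euclidean_space set"
  assumes P: "P \<in> polytopes_2s d" and Q: "Q \<in> polytopes_2s d"
    and F: "F \<in> simplex_facets P" and F': "F' \<in> simplex_facets Q"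
  shows "\<exists>p. glueing p P F Q F'"
proof -
  have polyP: "polytope P" and polyQ: "polytope Q"
    using P Q by (auto simp: polytopes_2s_def)
  have faceF: "F face_of P" and faceF': "F' face_of Q"
    using F F' by (auto simp: simplex_facets_def facet_of_def)
  obtain V p0 where V: "finite V" "card V = d" "F = convex hull V" "p0 \<in> P" "p0 \<notin> F"
    "\<not> affine_dependent (insert p0 V)" "homog ` P \<subseteq> span (homog ` insert p0 V)"
    using simplex_facet_frame[OF P F] by blast
  obtain W q0 where W: "finite W" "card W = d" "F' = convex hull W" "q0 \<in> Q" "q0 \<notin> F'"
    "\<not> affine_dependent (insert q0 W)" "homog ` Q \<subseteq> span (homog ` insert q0 W)"
    using simplex_facet_frame[OF Q F'] by blast
  have p0V: "p0 \<notin> V" and q0W: "q0 \<notin> W"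
    using V(3,5) W(3,5) hull_inc by metis+
  obtain g where g: "bij_betw g V W"
    using finite_same_card_bij[OF V(1) W(1)] V(2) W(2) by auto
  have gW: "g v \<in> W" if "v \<in> V" for v
    using g that by (auto simp: bij_betw_def)
  have gV: "g ` V = W" using g by (simp add: bij_betw_def)
  have g_eq: "g v = g v' \<longleftrightarrow> v = v'" if "v \<in> V" "v' \<in> V" for v v'
    using g that by (auto simp: bij_betw_def dest: inj_onD)

  \<comment> \<open>The vertex bijection, extended by sending \<open>p0\<close> to
    \<open>q0\<close>, matches the homogeneous bases of the two frames; \<open>L1\<close> is an
    injective linear extension of this matching.\<close>
  define h where "h = g(p0 := q0)"
  have h: "h p0 = q0" "\<And>v. v \<in> V \<Longrightarrow> h v = g v"
    using p0V by (auto simp: h_def)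
  have hV: "h ` V = W"
    using gV h(2) by (metis image_cong)
  have "inj_on h V"
    using g h(2) by (simp add: bij_betw_def cong: inj_on_cong)
  then have h_inj: "inj_on h (insert p0 V)"
    using hV h(1) p0V q0W by (simp add: inj_on_insert)
  have h_img: "h ` insert p0 V = insert q0 W"
    using h(1) hV by simp
  let ?f = "\<lambda>z. homog (h (fst z))"
  have f: "?f ` homog ` insert p0 V = homog ` insert q0 W"
    unfolding h_img[symmetric] by (simp only: image_image homog_def fst_conv)
  have "inj_on ?f (homog ` insert p0 V)"
    using h_inj inj_homog by (auto simp: inj_on_def homog_def)
  moreover have "independent (?f ` homog ` insert p0 V)"
    unfolding f by (rule homog_independent[OF W(6)])
  ultimately obtain L1 :: "'a \<times> real \<Rightarrow> 'a \<times> real" where L1: "linear L1" "inj L1"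
    and L1f: "\<And>z. z \<in> homog ` insert p0 V \<Longrightarrow> L1 z = ?f z"
    using linear_independent_extend_inj[OF homog_independent[OF V(6)], of ?f] by blast
  have L1V: "L1 (homog v) = homog (g v)" if "v \<in> V" for v
    using L1f[of "homog v"] h(2) that by (simp add: homog_def)
  have L1p: "L1 (homog p0) = homog q0"
    using L1f[of "homog p0"] h(1) by (simp add: homog_def)
  have L1_span: "L1 z \<in> span (homog ` insert q0 W)" if "z \<in> span (homog ` insert p0 V)" for z
  proof -
    have "L1 ` homog ` insert p0 V = homog ` insert q0 W"
      using L1V L1p gV by (auto simp: image_image)
    then show ?thesis
      using that span_linear_image[OF L1(1)] by (metis imageI)
  qed
  \<comment> \<open>All basis vectors and their images have last coordinate 1, so \<open>L1\<close>
    acts affinely on \<open>P\<close>.\<close>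
  have L1_snd: "snd (L1 z) = snd z" if "z \<in> span (homog ` insert p0 V)" for z
  proof -
    have "linear (\<lambda>z. snd (L1 z))"
      using linear_compose[OF L1(1) linear_snd] by (simp add: o_def)
    then show ?thesis
      by (rule linear_eq_on_span[OF _ linear_snd _ that]) (use L1V L1p in \<open>auto simp: homog_def\<close>)
  qed

  obtain c0 :: "'a \<times> real \<Rightarrow> real" where c0: "linear c0"
    and "\<And>x. x \<in> insert q0 W \<Longrightarrow> c0 (homog x) = (if x = q0 then 1 else 0)"
    using homog_dual_functional[OF W(6), of "\<lambda>x. if x = q0 then 1 else 0"] by blast
  then have c0q: "c0 (homog q0) = 1" and c0W: "\<And>w. w \<in> W \<Longrightarrow> c0 (homog w) = 0"
    using q0W by (auto split: if_splits)
  have ex: "\<forall>w. \<exists>f :: 'a \<times> real \<Rightarrow> real. linear f \<and>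
      (\<forall>x\<in>insert q0 W. f (homog x) = (if w = x then 1 else 0))"
  proof
    fix w
    obtain f :: "'a \<times> real \<Rightarrow> real" where "linear f"
      "\<And>x. x \<in> insert q0 W \<Longrightarrow> f (homog x) = (if w = x then 1 else 0)"
      using homog_dual_functional[OF W(6), of "\<lambda>x. if w = x then 1 else 0"] by blast
    then show "\<exists>f :: 'a \<times> real \<Rightarrow> real. linear f \<and>
        (\<forall>x\<in>insert q0 W. f (homog x) = (if w = x then 1 else 0))"
      by (intro exI[of _ f] conjI ballI)
  qed
  from choice[OF ex] obtain c :: "'a \<Rightarrow> 'a \<times> real \<Rightarrow> real" where "\<forall>w. linear (c w) \<and>
      (\<forall>x\<in>insert q0 W. c w (homog x) = (if w = x then 1 else 0))"
    by (rule exE)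
  then have c: "\<And>w. linear (c w)"
    and cx: "\<And>w x. x \<in> insert q0 W \<Longrightarrow> c w (homog x) = (if w = x then 1 else 0)"
    by blast+
  have cq: "c w (homog q0) = 0" if "w \<in> W" for w
    using cx[of q0 w] that q0W by auto
  have cW: "c w (homog x) = (if w = x then 1 else 0)" if "x \<in> W" for w x
    using cx that by blast

  have cl: "linear (c w)" if "w \<in> W" for w
    by (rule c)
  have cWW: "c w (homog x) = (if w = x then 1 else 0)" if "w \<in> W" "x \<in> W" for w x
    using that(2) by (rule cW)
  interpret Q: facet_frame Q F' W q0 c0 c
    by (rule facet_frame.intro) (fact polyQ faceF' W c0 c0q c0W cq cl cWW)+
  \<comment> \<open>Pulling the functionals of \<open>Q\<close> back along \<open>L1\<close> lets
    the slopes of \<open>P\<close> and \<open>Q\<close> be compared in the same coordinates.\<close>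
  interpret P: facet_frame P F V p0 "\<lambda>z. c0 (L1 z)" "\<lambda>v z. c (g v) (L1 z)"
  proof (rule facet_frame.intro)
    show "linear (\<lambda>z. c0 (L1 z))" "linear (\<lambda>z. c (g v) (L1 z))" for v
      using linear_compose[OF L1(1) c0] linear_compose[OF L1(1) c] by (simp_all add: o_def)
    show "c0 (L1 (homog p0)) = 1" using L1p c0q by simp
    fix v assume v: "v \<in> V"
    show "c0 (L1 (homog v)) = 0" using L1V[OF v] c0W[OF gW[OF v]] by simp
    show "c (g v) (L1 (homog p0)) = 0" using L1p cq[OF gW[OF v]] by simp
    fix w assume w: "w \<in> V"
    show "c (g v) (L1 (homog w)) = (if v = w then 1 else 0)"
      using L1V[OF w] cW[OF gW[OF w]] g_eq[OF v w] by simp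
  qed (fact polyP faceF V)+

  obtain M1 where M1: "0 \<le> M1"
    "\<And>x v. x \<in> P \<Longrightarrow> v \<in> V \<Longrightarrow> - M1 * c0 (L1 (homog x)) \<le> c (g v) (L1 (homog x))"
    using P.slope_bound by blast
  obtain M2 where M2: "0 \<le> M2"
    "\<And>x w. x \<in> Q \<Longrightarrow> w \<in> W \<Longrightarrow> - M2 * c0 (homog x) \<le> c w (homog x)"
    using Q.slope_bound by blast
  \<comment> \<open>\<open>M1 + M2\<close> is exceeded in order to obtain
    \<open>M2 < M - M1\<close>; the summand 2 also gives \<open>M \<ge> 2\<close>, which makes the
    last coordinate of \<open>r\<close> nonpositive.\<close>
  define M where "M = M1 + M2 + 2"
  \<comment> \<open>The coefficient 2 gives \<open>c0 r = 2\<close>, so that \<open>T\<close>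
    reverses \<open>c0\<close>; the coefficient \<open>- M\<close> adds \<open>M\<close> times
    \<open>c0\<close> to each \<open>c w\<close>.\<close>
  define r where "r = 2 *\<^sub>R homog q0 - M *\<^sub>R (\<Sum>w\<in>W. homog w)"
  define T where "T z = z - c0 z *\<^sub>R r" for z
  define L where "L z = T (L1 z)" for z
  have c0r: "c0 r = 2"
    unfolding r_def linear_diff[OF c0] linear_cmul[OF c0] linear_sum[OF c0]
    by (simp add: c0q c0W)
  have cr: "c w r = - M" if "w \<in> W" for w
  proof -
    have "(\<Sum>x\<in>W. c w (homog x)) = (\<Sum>x\<in>W. if w = x then 1 else 0)"
      using cW by (intro sum.cong) auto
    then show ?thesis
      using that W(1) unfolding r_def linear_diff[OF c] linear_cmul[OF c] linear_sum[OF c]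
      by (simp add: cq)
  qed
  have r_span: "r \<in> span (homog ` insert q0 W)"
    unfolding r_def by (intro span_diff span_scale span_sum span_base) auto
  have "snd r = 2 - M * real d"
    using W(2) by (simp add: r_def homog_def snd_sum)
  have linT: "linear T"
    unfolding T_def using linear_compose_sub[OF linear_id[unfolded id_def] linear_scaleR_const[OF c0]] .
  \<comment> \<open>\<open>T\<close> is an involution because \<open>c0 r = 2\<close>; its
    bijectivity yields that of \<open>L\<close>.\<close>
  have TT: "T (T z) = z" for z
    by (simp add: T_def linear_diff[OF c0] linear_cmul[OF c0] c0r algebra_simps scaleR_2)
  have linL: "linear L"
    using linear_compose[OF L1(1) linT] unfolding L_def[abs_def] o_def .
  have "bij T" using TT by (rule involuntory_imp_bij)
  moreover have "bij L1" using L1 by (simp add: bij_def linear_injective_imp_surjective)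
  ultimately have "bij L"
    using bij_comp[of L1 T] by (simp add: L_def[abs_def] o_def)

  have hP: "homog x \<in> span (homog ` insert p0 V)" if "x \<in> P" for x
    using V(7) that by blast
  have c0L: "c0 (L z) = - c0 (L1 z)" for z
    by (simp add: L_def T_def linear_diff[OF c0] linear_cmul[OF c0] c0r)
  have cL: "c w (L z) = c w (L1 z) + M * c0 (L1 z)" if "w \<in> W" for w z
    using cr[OF that] by (simp add: L_def T_def linear_diff[OF c] linear_cmul[OF c])
  \<comment> \<open>For \<open>d = 0\<close> the vertex set \<open>W\<close> and hence
    \<open>F'\<close> would be empty, but a facet is nonempty.\<close>
  have "d \<noteq> 0"
    using F' W(1,2,3) by (auto simp: simplex_facets_def facet_of_def)
  have snd_L: "0 < snd (L (homog x))" if x: "x \<in> P" for x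
  proof -
    have "2 \<le> M" using M1(1) M2(1) by (simp add: M_def)
    then have "2 * 1 \<le> M * real d" using \<open>d \<noteq> 0\<close> by (intro mult_mono) auto
    then have "snd r \<le> 0" using \<open>snd r = _\<close> by simp
    then have "0 \<le> - (c0 (L1 (homog x)) * snd r)"
      using P.c0_nonneg[OF x] by (simp add: mult_nonneg_nonpos)
    moreover have "snd (L (homog x)) = 1 - c0 (L1 (homog x)) * snd r"
      using L1_snd[OF hP[OF x]] by (simp add: L_def T_def) (simp add: homog_def)
    ultimately show ?thesis by simp
  qed
  define p where "p x = fst (L (homog x)) /\<^sub>R snd (L (homog x))" for x
  have map: "projective_map_on P L p"
    using linL \<open>bij L\<close> snd_L unfolding projective_map_on_def p_def by blast
  have convP: "convex P" using polyP by (rule polytope_imp_convex)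
  note seg = projective_map_on_preserves_segments[OF map convP]
  have VP: "V \<subseteq> P"
    using V(3) face_of_imp_subset[OF faceF] hull_subset[of V convex] by blast
  have pV: "p v = g v" if "v \<in> V" for v
    using that L1V c0W gW by (simp add: p_def L_def T_def) (simp add: homog_def)
  have pF: "p ` F = F'"
    using image_convex_hull_preserves_segments[OF seg convP VP] pV gV V(3) W(3)
    by (metis image_cong)
  have hp: "homog (p x) = inverse (snd (L (homog x))) *\<^sub>R L (homog x)" if "x \<in> P" for x
    using projective_map_onD[OF map that] snd_L[OF that]
    by (metis less_irrefl scaleR_scaleR left_inverse scaleR_one)

  interpret opposite_polytope Q F' W q0 c0 c "p ` P" "M - M1" M2
  proof
    show "polytope (p ` P)" using projective_map_on_polytope[OF map polyP] .
    show "F' face_of p ` P"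
      using face_of_image_preserves_segments[OF seg convP faceF] pF by simp
    show "M2 < M - M1" by (simp add: M_def)
    show "- M2 * c0 (homog x) \<le> c w (homog x)" if "x \<in> Q" "w \<in> W" for x w
      using M2(2) that .
    show "homog ` p ` P \<subseteq> span (homog ` insert q0 W)"
    proof
      fix z assume "z \<in> homog ` p ` P"
      then obtain x where x: "x \<in> P" "z = homog (p x)" by blast
      show "z \<in> span (homog ` insert q0 W)"
        unfolding x(2) hp[OF x(1)] L_def T_def
        using L1_span[OF hP[OF x(1)]] r_span by (intro span_scale span_diff)
    qed
  next
    fix y assume "y \<in> p ` P"
    then obtain x where x: "x \<in> P" "y = p x" by blast
    \<comment> \<open>Normalizing the last coordinate to 1 multiplies all functionals by the same
      positive \<open>t\<close>, so homogeneous inequalities survive.\<close>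
    define t where "t = inverse (snd (L (homog x)))"
    have t: "0 < t" using snd_L[OF x(1)] by (simp add: t_def)
    have y: "homog y = t *\<^sub>R L (homog x)" using hp x by (simp add: t_def)
    have c0y: "c0 (homog y) = - (t * c0 (L1 (homog x)))"
      unfolding y linear_cmul[OF c0] by (simp add: c0L)
    show "c0 (homog y) \<le> 0"
      using c0y t P.c0_nonneg[OF x(1)] by simp
    show "y \<in> F'" if "c0 (homog y) = 0"
      using that c0y t P.zero_in_F[OF x(1)] x(2) pF by auto
    show "- (M - M1) * c0 (homog y) \<le> c w (homog y)" if w: "w \<in> W" for w
    proof -
      obtain v where v: "v \<in> V" "w = g v" using w gV by blast
      have "- M1 * c0 (L1 (homog x)) \<le> c w (L1 (homog x))"
        using M1(2) x v by blast
      then have "(M - M1) * c0 (L1 (homog x)) \<le> c w (L (homog x))"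
        unfolding cL[OF w] by (simp add: algebra_simps)
      then have "t * ((M - M1) * c0 (L1 (homog x))) \<le> t * c w (L (homog x))"
        using t by (intro mult_left_mono) auto
      moreover have "c w (homog y) = t * c w (L (homog x))"
        unfolding y linear_cmul[OF c] by simp
      ultimately show ?thesis
        unfolding c0y by (simp add: algebra_simps)
    qed
  qed

  have "snd (L (x, 1)) \<noteq> 0 \<and> p x = fst (L (x, 1)) /\<^sub>R snd (L (x, 1))" if "x \<in> P" for x
    using snd_L[OF that] unfolding p_def homog_def by simp
  then have "projective_transformation_on P p"
    using linL \<open>bij L\<close> unfolding projective_transformation_on_def by blast
  then have "glueing p P F Q F'"
    unfolding glueing_def using Int_eq pF polytope_union face_of_union by blast
  then show ?thesis by blast
qed

section \<open>Face numbers of glued polytopes\<close>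

lemma image_faces_eq:
  assumes p: "projective_map_on P L p" and P: "convex P"
  shows "{G. G face_of p ` P \<and> aff_dim G = i} = (`) p ` {G. G face_of P \<and> aff_dim G = i}"
proof -
  have "aff_dim (p ` G) = aff_dim G" if "G face_of P" for G
    using projective_map_on_aff_dim[OF p face_of_imp_subset[OF that]] .
  then show ?thesis
    unfolding face_of_image_iff[OF projective_map_on_preserves_segments[OF p P] P] by auto
qed

lemma inj_on_image_faces:
  assumes p: "projective_map_on P L p" and P: "convex P"
  shows "inj_on ((`) p) {G. G face_of P \<and> R G}"
proof -
  have "inj_on p P"
    using projective_map_on_preserves_segments[OF p P] by (simp add: preserves_segments_on_def)
  then show ?thesis
    by (auto intro!: inj_onI dest!: face_of_imp_subset simp: inj_on_image_eq_iff)
qed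

lemma fvector_projective_image:
  assumes "projective_map_on P L p" "convex P"
  shows "fvector d (p ` P) = fvector d P"
  unfolding fvector_def image_faces_eq[OF assms] card_image[OF inj_on_image_faces[OF assms]] ..

lemma simplex_facets_projective_image:
  assumes p: "projective_map_on P L p" and P: "convex P" and F: "F \<in> simplex_facets P"
  shows "p ` F \<in> simplex_facets (p ` P)"
proof -
  have F: "F face_of P" "F \<noteq> {}" "aff_dim F = aff_dim P - 1" "(aff_dim P - 1) simplex F"
    using F by (auto simp: simplex_facets_def facet_of_def)
  have sub: "F \<subseteq> P" using F(1) by (rule face_of_imp_subset)
  have "p ` F face_of p ` P"
    using face_of_image_preserves_segments[OF projective_map_on_preserves_segments[OF p P] P F(1)] .
  then show ?thesis
    using F projective_map_on_aff_dim[OF p sub] projective_map_on_aff_dim[OF p subset_refl]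
      projective_map_on_simplex[OF p P sub F(4)]
    by (simp add: simplex_facets_def facet_of_def)
qed

lemma finite_simplex_facets:
  assumes "polytope P"
  shows "finite (simplex_facets P)"
  by (rule finite_subset[OF _ finite_polytope_faces[OF assms]])
    (auto simp: simplex_facets_def facet_of_def)

lemma polytopes_2s_projective_image:
  assumes p: "projective_map_on P L p" and P: "P \<in> polytopes_2s d"
  shows "p ` P \<in> polytopes_2s d"
proof -
  have P': "polytope P" "aff_dim P = int d" "2 \<le> card (simplex_facets P)"
    using P by (auto simp: polytopes_2s_def)
  have conv: "convex P" using P'(1) by (rule polytope_imp_convex)
  have poly: "polytope (p ` P)" using projective_map_on_polytope[OF p P'(1)] .
  have "simplex_facets P \<subseteq> {G. G face_of P \<and> True}"
    by (auto simp: simplex_facets_def facet_of_def)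
  then have "inj_on ((`) p) (simplex_facets P)"
    by (rule inj_on_subset[OF inj_on_image_faces[OF p conv]])
  moreover have "(`) p ` simplex_facets P \<subseteq> simplex_facets (p ` P)"
    using simplex_facets_projective_image[OF p conv] by blast
  ultimately have "card (simplex_facets P) \<le> card (simplex_facets (p ` P))"
    using finite_simplex_facets[OF poly] by (intro card_inj_on_le)
  then show ?thesis
    using P' poly projective_map_on_aff_dim[OF p subset_refl] by (simp add: polytopes_2s_def)
qed

section \<open>Counting the faces of a glued union\<close>

lemma card_faces_simplex:
  fixes F :: "'a::euclidean_space set"
  assumes "(int d - 1) simplex F"
  shows "card {G. G face_of F \<and> aff_dim G = int i} = d choose (i + 1)"
proof -
  obtain C where "\<not> affine_dependent C" "card C = d" "F = convex hull C"
    using assms by (auto simp: simplex_def)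
  then show ?thesis using card_faces_affine_independent by blast
qed

text \<open>Each side loses only the simplex facet \<open>F\<close> and keeps at least one other.
  The retained facets of the two sides are distinct, so the union again has two.\<close>

lemma facet_union_glued:
  fixes P Q :: "'a::euclidean_space set"
  assumes d: "d \<ge> 2" and P: "P \<in> polytopes_2s d" and Q: "Q \<in> polytopes_2s d"
    and F: "F \<in> simplex_facets P" "F \<in> simplex_facets Q"
    and Int: "P \<inter> Q = F" and poly: "polytope (P \<union> Q)"
    and faces: "\<And>G. G face_of F \<Longrightarrow> G \<noteq> F \<Longrightarrow> G face_of (P \<union> Q)"
  shows "P \<union> Q \<in> polytopes_2s d" "fvector d (P \<union> Q) = boxplus d (fvector d P) (fvector d Q)"
proof -
  have P': "polytope P" "aff_dim P = int d" "2 \<le> card (simplex_facets P)"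
    and Q': "polytope Q" "aff_dim Q = int d" "2 \<le> card (simplex_facets Q)"
    using P Q by (auto simp: polytopes_2s_def)
  interpret facet_union P Q F d
  proof
    show "closed P" "closed Q" "convex P" "convex Q" "convex (P \<union> Q)"
      using P'(1) Q'(1) poly by (simp_all add: polytope_imp_closed polytope_imp_convex)
    show "F facet_of P" "F facet_of Q" using F by (simp_all add: simplex_facets_def)
  qed (fact P'(2) Q'(2) Int faces)+
  have simp: "(int d - 1) simplex F"
    using F P' by (simp add: simplex_facets_def)
  have "F face_of F" using face_of_refl facet(1) face_of_imp_convex facet_of_def by blast
  let ?N = "\<lambda>S i. {G. G face_of S \<and> aff_dim G = int i}"
  have fin: "finite (?N P i)" "finite (?N Q i)" for i
    using finite_polytope_faces P' Q' by (auto intro: finite_subset[rotated])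
  have top: "F \<in> ?N S i \<longleftrightarrow> i = d - 1" if "F face_of S" for S :: "'a set" and i
    using that dim_F d by auto
  have minus: "int (card (?N S i - {F})) = int (card (?N S i)) - (if i = d - 1 then 1 else 0)"
    if "F face_of S" "finite (?N S i)" for S :: "'a set" and i
  proof (cases "i = d - 1")
    case True
    then have mem: "F \<in> ?N S i" using top[OF that(1)] by blast
    then have "card (?N S i) \<noteq> 0" using that(2) by auto
    then show ?thesis using mem True by simp
  next
    case False
    then have "F \<notin> ?N S i" using top[OF that(1)] by blast
    then show ?thesis using False by simp
  qed
  have FP: "F face_of P" and FQ: "F face_of Q"
    using facet by (auto simp: facet_of_def)
  \<comment> \<open>Inclusion-exclusion over the faces other than \<open>F\<close>: the proper faces
    of \<open>F\<close> are counted on both sides, and \<open>F\<close> itself is removed from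
    both.\<close>
  have count: "int (card (?N (P \<union> Q) i)) = int (card (?N P i)) + int (card (?N Q i)) -
      (if i = d - 1 then 2 else int (d choose (i + 1)))" if i: "i < d" for i
  proof -
    have "card (?N P i - {F}) + card (?N Q i - {F})
        = card (?N (P \<union> Q) i) + card (?N F i - {F})"
      unfolding faces_Un[OF i] faces_Int[symmetric] using fin by (intro card_Un_Int) auto
    then have "int (card (?N P i - {F})) + int (card (?N Q i - {F}))
        = int (card (?N (P \<union> Q) i)) + int (card (?N F i - {F}))"
      by (simp only: of_nat_add[symmetric])
    moreover have "finite (?N F i)"
      using finite_polytope_faces[OF simplex_imp_polytope[OF simp]] by (rule finite_subset[rotated]) auto
    note minus[OF \<open>F face_of F\<close> this]
    \<comment> \<open>At \<open>i = d - 1\<close> the binomial is 1 and the correction for removing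
      \<open>F\<close> is 1, which explains the appended entry 2.\<close>
    moreover have "(if i = d - 1 then 2 else int (d choose (i + 1)))
        = int (card (?N F i)) + (if i = d - 1 then 1 else 0)"
      using d unfolding card_faces_simplex[OF simp] by simp
    ultimately show ?thesis
      using minus[OF FP fin(1)[of i]] minus[OF FQ fin(2)[of i]] by linarith
  qed
  show "fvector d (P \<union> Q) = boxplus d (fvector d P) (fvector d Q)"
    by (rule eq_vecI) (simp_all add: fvector_def boxplus_def simplex_fvector_2_def count)
  have "G \<in> simplex_facets (P \<union> Q)" if "G \<in> simplex_facets P \<union> simplex_facets Q" "G \<noteq> F" for G
  proof -
    have G: "G face_of P \<or> G face_of Q" "G \<noteq> {}" "aff_dim G = int d - 1" "(int d - 1) simplex G"
      using that dim by (auto simp: simplex_facets_def facet_of_def)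
    then have "G face_of (P \<union> Q)"
      using face_Un[of G] facet_union.face_Un[OF commute, of G] that(2)
      unfolding Un_commute[of Q P] by auto
    then show ?thesis
      using G aff_dim_Un by (simp add: simplex_facets_def facet_of_def)
  qed
  then have facets: "(simplex_facets P - {F}) \<union> (simplex_facets Q - {F}) \<subseteq> simplex_facets (P \<union> Q)"
    by blast
  \<comment> \<open>A common facet lies in \<open>P \<inter> Q = F\<close> and has the dimension of
    \<open>F\<close>, hence equals it.\<close>
  have "simplex_facets P \<inter> simplex_facets Q \<subseteq> {F}"
  proof
    fix G assume G: "G \<in> simplex_facets P \<inter> simplex_facets Q"
    then have "G face_of P" "G face_of Q" "aff_dim G = int d - 1"
      using dim by (auto simp: simplex_facets_def facet_of_def)
    moreover from this have "G \<subseteq> F"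
      using Int face_of_imp_subset by blast
    ultimately have "G face_of F"
      using Int by (metis face_of_subset inf_le1)
    then have "G = F"
      using face_of_aff_dim_lt[OF face_of_imp_convex[OF FP]] dim_F \<open>aff_dim G = _\<close> by fastforce
    then show "G \<in> {F}" by simp
  qed
  then have "card ((simplex_facets P - {F}) \<union> (simplex_facets Q - {F}))
      = card (simplex_facets P - {F}) + card (simplex_facets Q - {F})"
    using finite_simplex_facets P' Q' by (intro card_Un_disjoint) auto
  moreover have "card ((simplex_facets P - {F}) \<union> (simplex_facets Q - {F})) \<le> card (simplex_facets (P \<union> Q))"
    using facets finite_simplex_facets[OF poly] by (intro card_mono) auto
  ultimately have "2 \<le> card (simplex_facets (P \<union> Q))"
    using P'(3) Q'(3) F by (simp add: card_Diff_singleton)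
  then show "P \<union> Q \<in> polytopes_2s d"
    using poly aff_dim_Un by (simp add: polytopes_2s_def)
qed

lemma glueing_result:
  fixes P Q :: "'a::euclidean_space set"
  assumes d: "d \<ge> 2" and P: "P \<in> polytopes_2s d" and Q: "Q \<in> polytopes_2s d"
    and F: "F \<in> simplex_facets P" and F': "F' \<in> simplex_facets Q" and glue: "glueing p P F Q F'"
  shows "p ` P \<union> Q \<in> polytopes_2s d \<and>
    fvector d (p ` P \<union> Q) = boxplus d (fvector d P) (fvector d Q)"
proof -
  have conv: "convex P"
    using P by (auto simp: polytopes_2s_def polytope_imp_convex)
  obtain L where p: "projective_map_on P L p"
    using glue projective_transformation_on_imp_map[OF _ conv] by (auto simp: glueing_def)
  have "F' \<in> simplex_facets (p ` P)"
    using simplex_facets_projective_image[OF p conv F] glue by (simp add: glueing_def)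
  moreover have "p ` P \<inter> Q = F'" "polytope (p ` P \<union> Q)"
    "\<And>G. G face_of F' \<Longrightarrow> G \<noteq> F' \<Longrightarrow> G face_of (p ` P \<union> Q)"
    using glue unfolding glueing_def by blast+
  ultimately show ?thesis
    using facet_union_glued[OF d polytopes_2s_projective_image[OF p P] Q _ F']
    unfolding fvector_projective_image[OF p conv] by blast
qed

theorem proposition5p4:
  fixes d :: nat
  assumes "d \<ge> 2"
  shows
    "fvector d ` (polytopes_2s d :: 'a::euclidean_space set set) \<subseteq> carrier_vec d \<and>
     affine_semigroup (fvector d ` (polytopes_2s d :: 'a set set)) (boxplus d) \<and>
     (\<forall>P \<in> (polytopes_2s d :: 'a set set). \<forall>Q \<in> polytopes_2s d.
        \<forall>F \<in> simplex_facets P. \<forall>F' \<in> simplex_facets Q.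
          (\<exists>\<pi>. glueing \<pi> P F Q F') \<and>
          (\<forall>\<pi>. glueing \<pi> P F Q F' \<longrightarrow>
             \<pi> ` P \<union> Q \<in> polytopes_2s d \<and>
             fvector d (\<pi> ` P \<union> Q) = boxplus d (fvector d P) (fvector d Q)))"
proof (intro conjI)
  let ?S = "fvector d ` (polytopes_2s d :: 'a set set)" and ?s = "simplex_fvector_2 d"
  show carrier: "?S \<subseteq> carrier_vec d"
    by (auto simp: fvector_def)
  show "\<forall>P \<in> (polytopes_2s d :: 'a set set). \<forall>Q \<in> polytopes_2s d.
        \<forall>F \<in> simplex_facets P. \<forall>F' \<in> simplex_facets Q.
          (\<exists>\<pi>. glueing \<pi> P F Q F') \<and>
          (\<forall>\<pi>. glueing \<pi> P F Q F' \<longrightarrow>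
             \<pi> ` P \<union> Q \<in> polytopes_2s d \<and>
             fvector d (\<pi> ` P \<union> Q) = boxplus d (fvector d P) (fvector d Q))"
    using ex_glueing glueing_result[OF assms] by blast
  have s: "?s \<in> carrier_vec d" by (simp add: simplex_fvector_2_def)
  have closed: "boxplus d x y \<in> ?S" if xy: "x \<in> ?S" "y \<in> ?S" for x y
  proof -
    obtain P Q :: "'a set" where PQ: "P \<in> polytopes_2s d" "x = fvector d P"
      "Q \<in> polytopes_2s d" "y = fvector d Q"
      using xy by blast
    \<comment> \<open>Each polytope offers a simplex facet, so a glueing exists and its union
      realizes the modified sum.\<close>
    then have "simplex_facets P \<noteq> {}" "simplex_facets Q \<noteq> {}"
      by (auto simp: polytopes_2s_def)
    then obtain F F' p where "F \<in> simplex_facets P" "F' \<in> simplex_facets Q" "glueing p P F Q F'"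
      using ex_glueing PQ by blast
    then show ?thesis
      using glueing_result[OF assms PQ(1,3)] PQ(2,4) by (metis imageI)
  qed
  have add: "boxplus d x y - ?s = (x - ?s) + (y - ?s)" if "x \<in> ?S" "y \<in> ?S" for x y
  proof -
    have "x \<in> carrier_vec d" "y \<in> carrier_vec d" using that carrier by auto
    then show ?thesis using s by (intro eq_vecI) (auto simp: boxplus_def)
  qed
  have "inj_on (\<lambda>x. x - ?s) ?S"
  proof (rule inj_onI)
    fix x y assume "x \<in> ?S" "y \<in> ?S" and eq: "x - ?s = y - ?s"
    \<comment> \<open>Adding \<open>?s\<close> back recovers a vector only when its dimension is
      \<open>d\<close>, hence the appeal to \<open>carrier\<close>.\<close>
    then have "x \<in> carrier_vec d" "y \<in> carrier_vec d" using carrier by auto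
    moreover from this have "x = (x - ?s) + ?s" "y = (y - ?s) + ?s"
      using s by (auto intro!: eq_vecI)
    ultimately show "x = y" using eq by simp
  qed
  then have bij: "bij_betw (\<lambda>x. x - ?s) ?S ((\<lambda>x. x - ?s) ` ?S)"
    by (rule inj_on_imp_bij_betw)
  have sub: "(\<lambda>x. x - ?s) ` ?S \<subseteq> carrier_vec d"
    using s carrier by auto
  have "u + v \<in> (\<lambda>x. x - ?s) ` ?S"
    if u: "u \<in> (\<lambda>x. x - ?s) ` ?S" and v: "v \<in> (\<lambda>x. x - ?s) ` ?S" for u v
  proof -
    obtain x where x: "x \<in> ?S" "u = x - ?s" using u by blast
    obtain y where y: "y \<in> ?S" "v = y - ?s" using v by blast
    have "u + v = boxplus d x y - ?s" using add x y by simp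
    then show ?thesis using closed[OF x(1) y(1)] by (rule image_eqI)
  qed
  then have rep: "(\<lambda>x. x - ?s) ` ?S \<subseteq> carrier_vec d \<and>
      (\<forall>u\<in>(\<lambda>x. x - ?s) ` ?S. \<forall>v\<in>(\<lambda>x. x - ?s) ` ?S. u + v \<in> (\<lambda>x. x - ?s) ` ?S) \<and>
      bij_betw (\<lambda>x. x - ?s) ?S ((\<lambda>x. x - ?s) ` ?S) \<and>
      (\<forall>x\<in>?S. \<forall>y\<in>?S. boxplus d x y - ?s = (x - ?s) + (y - ?s))"
    using sub bij add by (intro conjI ballI)
  show "affine_semigroup ?S (boxplus d)"
    unfolding affine_semigroup_def
  proof
    show "\<forall>x\<in>?S. \<forall>y\<in>?S. boxplus d x y \<in> ?S"
      using closed by (intro ballI)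
    show "\<exists>(n::nat) (T :: int Matrix.vec set) \<phi>.
        T \<subseteq> carrier_vec n \<and> (\<forall>u\<in>T. \<forall>v\<in>T. u + v \<in> T) \<and>
        bij_betw \<phi> ?S T \<and> (\<forall>x\<in>?S. \<forall>y\<in>?S. \<phi> (boxplus d x y) = \<phi> x + \<phi> y)"
      by (rule exI[of _ d], rule exI[of _ "(\<lambda>x. x - ?s) ` ?S"], rule exI[of _ "\<lambda>x. x - ?s"]) (fact rep)
  qed
qed

end
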